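(* Suppose $Q\in D_1$ is a normalized operator, i.e. $Q=\partial^q+c_{q-2}\partial^{q-2}+\dots+c_0$ with $c_i\in K[[x]]$, with $\mathbf{ord}(Q)=\deg(Q)=q>0$. Suppose $P\in\hat D_1^{sym}\hat\otimes_K\tilde K$ satisfies condition $A_q(0)$, $\mathbf{ord}(P)=p$. Put $P'=S^{-1}PS$, where $S\in\hat D_1^{sym}$ is a Schur operator for $Q$, i.e. $S$ is invertible, $\mathbf{ord}(S)=0$, $S^{-1}QS=\partial^q$, with homogeneous components $S_0=1$ and $S_{-1}=0$. Then $P'$ satisfies condition $A_q(0)$.
   Context: $K$ is a field of characteristic zero, $D_1=K[[x]][\partial]$. For a formal expression $P=\sum_{k\ge 0}a_k\partial^k$, $a_k\in K[[x]]$, put $\mathbf{ord}(P)=\sup\{k-v(a_k)\}$, $v$ the $x$-adic valuation. $\hat D_1^{sym}$ is the set of those with $\mathbf{ord}(P)<\infty$; it is a ring with multiplication extending that of $D_1$. $\xi$ is a primitive $q$-th root of unity, $\tilde K=K[\xi]$, and $\hat D_1^{sym}\hat\otimes_K\tilde K$ is the same ring over $\tilde K$. $P_m=\sum_{i-j=m}\alpha_{i,j}x^j\partial^i$ is the $m$-th homogeneous component of $P=\sum\alpha_{i,j}x^j\partial^i$, and $\sigma(P)=P_{\mathbf{ord}(P)}$. Operators: $\delta=\sum_{n\ge0}\frac{(-1)^n}{n!}x^n\partial^n$; $\int=\sum_{n\ge0}\frac{x^{n+1}}{(n+1)!}(-\partial)^n$; $D^r=\partial^r$ for $r\ge0$,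 $D^r=\int^{-r}$ for $r<0$; $B_j=\frac1{(j-1)!}x^{j-1}\delta\partial^{j-1}$ for $j\ge1$; $A_{q;i}=\sum_{n\ge0}\frac{(\xi^i-1)^n}{n!}x^n\partial^n$. A homogeneous canonical polynomial (HCP) from $Hcpc(q)$ is an element of the form $$H=\Big[\sum_{0\le i<q}\sum_{0\le l\le d_i}f_{l,i;r}x^lA_{q;i}\partial^l+\sum_{0<j\le N}g_{j;r}B_j\Big]D^r,\quad f_{l,i;r},g_{j;r}\in\tilde K,\ r\in\mathbb Z,$$ with $g_{j;r}=0$ for $j\le -r$ if $r<0$; this form is unique. $Sdeg_A(H)$ is the largest $l$ with some $f_{l,i;r}\ne0$ ($-\infty$ if none); $Sdeg_B(H)$ is the largest $j$ with $g_{j;r}\neq0$ ($-\infty$ if none). $H$ does not contain $A_{q;i}$ if $f_{l,i;r}=0$ for all $i>0$ and all $l$. $H$ is totally free of $B_j$ if $Sdeg_B(HD^s)=-\infty$ for all $s\in\mathbb Z$. $P$ satisfies condition $A_q(k)$ (defined for $q,k\in\mathbb Z_{\ge 0}$, $q>1$) if: (1) $P_t$ is an HCP from $Hcpc(q)$ for all $t$; (2) $P_t$ is totally free of $B_j$ for all $t$; (3) $Sdeg_A(P_{\mathbf{ord}(P)-i})<i+k$ for all $i>0$; (4) $\sigma(P)$ does not contain $A_{q;i}$ and $Sdeg_A(\sigma(P))=k$. *)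

theory Defs
  imports
    "HOL-Computational_Algebra.Formal_Power_Series"
    "HOL-Computational_Algebra.Polynomial"
    "HOL-Library.Extended_Real"
begin

unbundle fps_syntax

section \<open>The ring of operators\<close>

text \<open>A formal expression \<open>\<Sum>k. a\<^sub>k \<partial>\<^sup>k\<close> is the sequence of its coefficients \<open>a\<^sub>k\<close>.\<close>

definition xval :: "'a::zero fps \<Rightarrow> ereal" where
  "xval f = (if f = 0 then \<infinity> else ereal (real (subdegree f)))"

definition seq_ord :: "(nat \<Rightarrow> 'a::zero fps) \<Rightarrow> ereal" where
  "seq_ord a = (SUP k. ereal (real k) - xval (a k))"

lemma seq_ord_le_iff:
  "seq_ord a \<le> ereal (real_of_int c) \<longleftrightarrow> (\<forall>k m. int k - int m > c \<longrightarrow> a k $ m = 0)"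
proof -
  have "ereal (real k) - xval (a k) \<le> ereal (real_of_int c) \<longleftrightarrow> (\<forall>m. int k - int m > c \<longrightarrow> a k $ m = 0)"
    for k
  proof (cases "a k = 0")
    case False
    have "(\<forall>m. int k - int m > c \<longrightarrow> a k $ m = 0) \<longleftrightarrow> int k - int (subdegree (a k)) \<le> c"
    proof
      assume "\<forall>m. int k - int m > c \<longrightarrow> a k $ m = 0"
      then show "int k - int (subdegree (a k)) \<le> c"
        using nth_subdegree_nonzero[OF False] by (meson not_le)
    next
      assume *: "int k - int (subdegree (a k)) \<le> c"
      show "\<forall>m. int k - int m > c \<longrightarrow> a k $ m = 0"
      proof (intro allI impI)
        fix m assume "int k - int m > c"
        with * have "m < subdegree (a k)" by linarith
        then show "a k $ m = 0" by (rule nth_less_subdegree_zero)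
      qed
    qed
    moreover have "ereal (real k) - xval (a k) \<le> ereal (real_of_int c)
        \<longleftrightarrow> real k - real (subdegree (a k)) \<le> real_of_int c"
      using False by (simp add: xval_def)
    moreover have "\<dots> \<longleftrightarrow> int k - int (subdegree (a k)) \<le> c" by linarith
    ultimately show ?thesis by simp
  qed (simp add: xval_def)
  then show ?thesis unfolding seq_ord_def SUP_le_iff by blast
qed

lemma seq_ord_finite_iff:
  "seq_ord a < \<infinity> \<longleftrightarrow> (\<exists>c::int. \<forall>k m. int k - int m > c \<longrightarrow> a k $ m = 0)"
proof
  assume "seq_ord a < \<infinity>"
  then obtain r where "seq_ord a \<le> ereal r"
    by (cases "seq_ord a") auto
  also have "ereal r \<le> ereal (real_of_int \<lceil>r\<rceil>)" by simp
  finally show "\<exists>c::int. \<forall>k m. int k - int m > c \<longrightarrow> a k $ m = 0"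
    unfolding seq_ord_le_iff by blast
next
  assume "\<exists>c::int. \<forall>k m. int k - int m > c \<longrightarrow> a k $ m = 0"
  then show "seq_ord a < \<infinity>" unfolding seq_ord_le_iff[symmetric]
    by (elim exE) (erule le_less_trans, simp)
qed

lemma seq_ord_finiteI:
  "(\<And>k m. int k - int m > c \<Longrightarrow> a k $ m = 0) \<Longrightarrow> seq_ord a < \<infinity>"
  unfolding seq_ord_finite_iff by blast

typedef (overloaded) 'a dsym = "{a :: nat \<Rightarrow> 'a::field_char_0 fps. seq_ord a < \<infinity>}"
  morphisms dcoeff Abs_dsym
  by (rule exI[of _ "\<lambda>_. 0"]) (unfold mem_Collect_eq, rule seq_ord_finiteI[of 0], simp)

setup_lifting type_definition_dsym

lemma dcoeff_bound: "\<exists>c::int. \<forall>k m. int k - int m > c \<longrightarrow> dcoeff P k $ m = 0"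
  using dcoeff[of P] unfolding mem_Collect_eq seq_ord_finite_iff .

lemma fps_sums_nth:
  fixes f :: "nat \<Rightarrow> 'a::comm_ring_1 fps"
  assumes "\<And>m i. B m \<le> i \<Longrightarrow> f i $ m = 0"
  shows "suminf f $ m = (\<Sum>i<B m. f i $ m)"
proof -
  have stable: "(\<Sum>i<n. f i $ m) = (\<Sum>i<B m. f i $ m)" if "n \<ge> B m" for n m
    using that assms by (intro sum.mono_neutral_right) auto
  have "f sums Abs_fps (\<lambda>m. \<Sum>i<B m. f i $ m)"
    unfolding sums_def
    by (rule tendsto_fpsI) (auto simp: fps_sum_nth eventually_sequentially intro!: stable)
  then show ?thesis by (simp add: sums_unique[symmetric])
qed

lemma fps_nth_deriv_nth:
  fixes f :: "'a::comm_ring_1 fps"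
  shows "fps_nth_deriv k f $ n = of_nat (\<Prod>{n+1..n+k}) * f $ (n + k)"
proof (induction k arbitrary: f)
  case (Suc k)
  have "\<Prod>{n+1..n+Suc k} = \<Prod>{n+1..n+k} * (n + Suc k)" by simp
  with Suc show ?case by (simp add: algebra_simps)
qed simp

instantiation dsym :: (field_char_0) "{zero,one,plus,minus,uminus,times}"
begin

lift_definition zero_dsym :: "'a dsym" is "\<lambda>_. 0"
  by (rule seq_ord_finiteI[of 0]) simp

lift_definition one_dsym :: "'a dsym" is "\<lambda>k. if k = 0 then 1 else 0"
  by (rule seq_ord_finiteI[of 0]) auto

lift_definition plus_dsym :: "'a dsym \<Rightarrow> 'a dsym \<Rightarrow> 'a dsym" is "\<lambda>a b k. a k + b k"
proof -
  fix a b :: "nat \<Rightarrow> 'a fps"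
  assume "seq_ord a < \<infinity>" "seq_ord b < \<infinity>"
  then obtain c d :: int where "\<forall>k m. int k - int m > c \<longrightarrow> a k $ m = 0"
    "\<forall>k m. int k - int m > d \<longrightarrow> b k $ m = 0"
    unfolding seq_ord_finite_iff by blast
  then show "seq_ord (\<lambda>k. a k + b k) < \<infinity>"
    by (intro seq_ord_finiteI[of "max c d"]) simp
qed

lift_definition uminus_dsym :: "'a dsym \<Rightarrow> 'a dsym" is "\<lambda>a k. - a k"
  unfolding seq_ord_finite_iff by simp

definition minus_dsym :: "'a dsym \<Rightarrow> 'a dsym \<Rightarrow> 'a dsym" where
  "minus_dsym P Q = P + - Q"

text \<open>The product extends the Leibniz rule \<open>\<partial>\<^sup>k b = \<Sum>i\<le>k. (k choose i) b\<^sup>(\<^sup>i\<^sup>) \<partial>\<^sup>k\<^sup>-\<^sup>i\<close>: the coefficient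
  of \<open>\<partial>\<^sup>n\<close> in \<open>a\<^sub>k \<partial>\<^sup>k b\<^sub>l \<partial>\<^sup>l\<close> is nonzero only for \<open>k = i + (n - l)\<close>. The inner series over \<open>i\<close>
  converges in the \<open>x\<close>-adic topology because the order of the first factor is finite.\<close>

lift_definition times_dsym :: "'a dsym \<Rightarrow> 'a dsym \<Rightarrow> 'a dsym" is
  "\<lambda>a b n. \<Sum>l\<le>n. \<Sum>i. of_nat ((i + (n - l)) choose i) * a (i + (n - l)) * fps_nth_deriv i (b l)"
proof -
  fix a b :: "nat \<Rightarrow> 'a fps"
  assume "seq_ord a < \<infinity>" "seq_ord b < \<infinity>"
  then obtain c d :: int where c: "\<And>k m. int k - int m > c \<Longrightarrow> a k $ m = 0"
    and d: "\<And>k m. int k - int m > d \<Longrightarrow> b k $ m = 0"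
    unfolding seq_ord_finite_iff by blast
  define t where "t n l i = of_nat ((i + (n - l)) choose i) * a (i + (n - l)) * fps_nth_deriv i (b l)"
    for n l i
  have t1: "t n l i $ m = 0" if "i \<ge> nat (int m + c + 1)" for n l i m
    unfolding t_def mult.assoc fps_of_nat[symmetric] fps_mult_left_const_nth
    using that by (auto simp: fps_mult_nth intro!: sum.neutral c disjI1)
  have t2: "t n l i $ m = 0" if "int n - int m > c + d" "l \<le> n" for n l i m
  proof -
    have "a (i + (n - l)) $ j * fps_nth_deriv i (b l) $ (m - j) = 0" if "j \<le> m" for j
    proof (cases "int (i + (n - l)) - int j > c")
      case False
      with \<open>int n - int m > c + d\<close> \<open>l \<le> n\<close> \<open>j \<le> m\<close> have "int l - int (m - j + i) > d" by linarith
      then show ?thesis by (simp add: fps_nth_deriv_nth d)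
    qed (simp add: c)
    then show ?thesis
      unfolding t_def mult.assoc fps_of_nat[symmetric] fps_mult_left_const_nth
      by (simp add: fps_mult_nth del: mult_eq_0_iff)
  qed
  have "(\<Sum>l\<le>n. \<Sum>i. t n l i) $ m = 0" if "int n - int m > c + d" for n m
    unfolding fps_sum_nth using t2[OF that]
    by (intro sum.neutral ballI, subst fps_sums_nth[where B = "\<lambda>m. nat (int m + c + 1)"]) (auto intro: t1)
  then show "seq_ord (\<lambda>n. \<Sum>l\<le>n. \<Sum>i. of_nat ((i + (n - l)) choose i) * a (i + (n - l)) * fps_nth_deriv i (b l)) < \<infinity>"
    unfolding t_def by (rule seq_ord_finiteI)
qed

instance ..
end


text \<open>The ring axioms are checked on the action on power series, which is faithful in
  characteristic zero.\<close>

definition act :: "'a::field_char_0 dsym \<Rightarrow> 'a fps \<Rightarrow> 'a fps" where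
  "act P f = (\<Sum>k. dcoeff P k * fps_nth_deriv k f)"

definition ord_bound :: "'a::field_char_0 dsym \<Rightarrow> int \<Rightarrow> bool" where
  "ord_bound P c \<longleftrightarrow> (\<forall>k m. int k - int m > c \<longrightarrow> dcoeff P k $ m = 0)"

lemma ord_boundE: obtains c where "ord_bound P c"
  using dcoeff_bound[of P] unfolding ord_bound_def by blast

lemma ord_bound_term:
  assumes "ord_bound P c" "nat (int m + c + 1) \<le> k"
  shows "(dcoeff P k * g) $ m = 0"
  using assms by (auto simp: ord_bound_def fps_mult_nth intro!: sum.neutral)

lemma act_nth:
  assumes "ord_bound P c" "nat (int m + c + 1) \<le> K"
  shows "act P f $ m = (\<Sum>k<K. (dcoeff P k * fps_nth_deriv k f) $ m)"
proof -
  have "act P f $ m = (\<Sum>k<nat (int m + c + 1). (dcoeff P k * fps_nth_deriv k f) $ m)"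
    unfolding act_def by (rule fps_sums_nth) (rule ord_bound_term[OF assms(1)])
  also have "\<dots> = (\<Sum>k<K. (dcoeff P k * fps_nth_deriv k f) $ m)"
    using assms(2) ord_bound_term[OF assms(1)] by (intro sum.mono_neutral_left) auto
  finally show ?thesis .
qed

lemma act_cong:
  assumes "ord_bound P c" "\<And>j. int j \<le> int m + c \<Longrightarrow> f $ j = g $ j"
  shows "act P f $ m = act P g $ m"
  unfolding act_nth[OF assms(1) order_refl]
proof (rule sum.cong[OF refl])
  fix k
  have "dcoeff P k $ j * fps_nth_deriv k f $ (m - j) = dcoeff P k $ j * fps_nth_deriv k g $ (m - j)"
    if "j \<le> m" for j
  proof (cases "int k - int j > c")
    case True
    then show ?thesis using assms(1) by (simp add: ord_bound_def)
  next
    case False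
    with that have "int (m - j + k) \<le> int m + c" by linarith
    then show ?thesis by (simp add: fps_nth_deriv_nth assms(2))
  qed
  then show "(dcoeff P k * fps_nth_deriv k f) $ m = (dcoeff P k * fps_nth_deriv k g) $ m"
    unfolding fps_mult_nth by (intro sum.cong) auto
qed

lemma act_add_right: "act P (f + g) = act P f + act P g"
proof (rule fps_ext)
  fix m
  obtain c where c: "ord_bound P c" by (rule ord_boundE)
  show "act P (f + g) $ m = (act P f + act P g) $ m"
    by (simp add: act_nth[OF c order_refl] algebra_simps sum.distrib)
qed

lemma ord_bound_mono: "ord_bound P c \<Longrightarrow> c \<le> d \<Longrightarrow> ord_bound P d"
  by (auto simp: ord_bound_def)

lemma act_add_left: "act (P + Q) f = act P f + act Q f"
proof (rule fps_ext)
  fix m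
  obtain c where c: "ord_bound P c" by (rule ord_boundE)
  obtain d where d: "ord_bound Q d" by (rule ord_boundE)
  define e where "e = max c d"
  have e: "ord_bound P e" "ord_bound Q e"
    unfolding e_def by (rule ord_bound_mono[OF c] ord_bound_mono[OF d], simp)+
  then have "ord_bound (P + Q) e" by (simp add: ord_bound_def plus_dsym.rep_eq)
  from this e show "act (P + Q) f $ m = (act P f + act Q f) $ m"
    by (simp add: act_nth[OF _ order_refl] algebra_simps sum.distrib plus_dsym.rep_eq)
qed

lemma act_1: "act 1 f = f"
proof (rule fps_ext)
  fix m
  have "ord_bound (1 :: 'a dsym) 0" by (auto simp: ord_bound_def one_dsym.rep_eq)
  then have "act (1 :: 'a dsym) f $ m = (\<Sum>k<Suc m. (dcoeff 1 k * fps_nth_deriv k f) $ m)"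
    by (rule act_nth) simp
  also have "\<dots> = (\<Sum>k<Suc m. if k = 0 then f $ m else 0)"
    by (rule sum.cong) (auto simp: one_dsym.rep_eq)
  finally show "act 1 f $ m = f $ m" by simp
qed

lemma act_faithful:
  assumes "\<And>f. act P f = act Q f"
  shows "P = Q"
proof -
  have "dcoeff P n = dcoeff Q n" for n
  proof (induction n rule: less_induct)
    case (less n)
    have D: "fps_nth_deriv k (fps_X ^ n :: 'a fps) = (if k = n then of_nat (fact n) else 0)" if "k \<ge> n" for k
    proof (rule fps_ext)
      fix m
      have "\<Prod>{1..n} = (fact n :: nat)" by (simp add: fact_prod)
      then have "of_nat (\<Prod>{1..n}) = (fact n :: 'a)" by (simp only: of_nat_fact)
      then show "fps_nth_deriv k (fps_X ^ n :: 'a fps) $ m = (if k = n then of_nat (fact n) else 0) $ m"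
        using that by (cases "m = 0") (auto simp: fps_nth_deriv_nth fps_X_power_nth fps_of_nat[symmetric] simp del: of_nat_prod)
    qed
    have *: "act R (fps_X ^ n) $ m =
        (\<Sum>k<n. (dcoeff R k * fps_nth_deriv k (fps_X ^ n)) $ m) + (dcoeff R n * of_nat (fact n)) $ m"
      for R :: "'a dsym" and m
    proof -
      obtain c where c: "ord_bound R c" by (rule ord_boundE)
      define K where "K = max (Suc n) (nat (int m + c + 1))"
      have "act R (fps_X ^ n) $ m = (\<Sum>k<K. (dcoeff R k * fps_nth_deriv k (fps_X ^ n)) $ m)"
        by (rule act_nth[OF c]) (simp add: K_def)
      also have "\<dots> = (\<Sum>k<Suc n. (dcoeff R k * fps_nth_deriv k (fps_X ^ n)) $ m)"
        by (rule sum.mono_neutral_right) (auto simp: K_def D)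
      finally show ?thesis by (simp add: D)
    qed
    have "dcoeff P n * of_nat (fact n) = dcoeff Q n * of_nat (fact n)"
      by (rule fps_ext) (use *[of P] *[of Q] assms less in simp)
    moreover have "of_nat (fact n) \<noteq> (0 :: 'a fps)" by simp
    ultimately show ?case by (metis mult_right_cancel)
  qed
  then show ?thesis by (metis dcoeff_inject ext)
qed

lemma fps_nth_deriv_mult:
  fixes f g :: "'a::comm_ring_1 fps"
  shows "fps_nth_deriv k (f * g) =
    (\<Sum>i\<le>k. of_nat (k choose i) * (fps_nth_deriv i f * fps_nth_deriv (k - i) g))"
proof (induction k)
  case (Suc k)
  let ?t = "\<lambda>i j. fps_nth_deriv i f * fps_nth_deriv j g"
  have "fps_nth_deriv (Suc k) (f * g) =
      (\<Sum>i\<le>k. of_nat (k choose i) * (?t (Suc i) (k - i) + ?t i (Suc (k - i))))"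
    unfolding fps_nth_deriv_commute Suc fps_deriv_sum
    by (intro sum.cong refl) (simp add: fps_nth_deriv_commute fps_of_nat[symmetric] algebra_simps
          del: fps_nth_deriv.simps(2))
  also have "\<dots> = (\<Sum>i\<le>k. of_nat (k choose i) * ?t (Suc i) (k - i))
      + (\<Sum>i\<le>k. of_nat (k choose i) * ?t i (Suc k - i))"
    by (simp add: distrib_left sum.distrib Suc_diff_le del: fps_nth_deriv.simps(2))
  also have "(\<Sum>i\<le>k. of_nat (k choose i) * ?t i (Suc k - i)) =
      (\<Sum>i\<le>Suc k. of_nat (k choose i) * ?t i (Suc k - i))"
    by (simp add: binomial_eq_0)
  also have "\<dots> = ?t 0 (Suc k) + (\<Sum>i\<le>k. of_nat (k choose Suc i) * ?t (Suc i) (k - i))"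
    by (subst sum.atMost_Suc_shift) simp
  also have "(\<Sum>i\<le>k. of_nat (k choose i) * ?t (Suc i) (k - i)) +
      (?t 0 (Suc k) + (\<Sum>i\<le>k. of_nat (k choose Suc i) * ?t (Suc i) (k - i))) =
      (\<Sum>i\<le>Suc k. of_nat (Suc k choose i) * ?t i (Suc k - i))"
    unfolding sum.atMost_Suc_shift by (simp add: sum.distrib distrib_right del: fps_nth_deriv.simps)
  finally show ?case .
qed simp

lemma act_mult: "act (P * Q) f = act P (act Q f)"
proof (rule fps_ext)
  fix m
  obtain c where c: "ord_bound P c" by (rule ord_boundE)
  obtain d where d: "ord_bound Q d" by (rule ord_boundE)
  obtain e where e: "ord_bound (P * Q) e" by (rule ord_boundE)
  text \<open>Only finitely many coefficients of \<open>f\<close> matter, so \<open>f\<close> may be replaced by a polynomial.\<close>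
  define N where "N = nat (int m + \<bar>c\<bar> + \<bar>d\<bar> + \<bar>e\<bar> + 1)"
  define h where "h = fps_cutoff N f"
  have h: "f $ j = h $ j" if "j < N" for j using that by (simp add: h_def)
  have h0: "fps_nth_deriv n h = 0" if "N \<le> n" for n
    by (rule fps_ext) (use that in \<open>simp add: fps_nth_deriv_nth h_def\<close>)
  have A: "act (P * Q) f $ m = act (P * Q) h $ m"
    by (rule act_cong[OF e], rule h) (auto simp: N_def)
  have B: "act P (act Q f) $ m = act P (act Q h) $ m"
    by (rule act_cong[OF c], rule act_cong[OF d], rule h) (auto simp: N_def)
  define K where "K = N"
  define U where "U l i n = of_nat ((i + n) choose i) *
    (dcoeff P (i + n) * (fps_nth_deriv i (dcoeff Q l) * fps_nth_deriv (l + n) h)) $ m" for l i n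
  have U0: "U l i n = 0" if "K \<le> i + n \<or> N \<le> l + n" for l i n
  proof (cases "N \<le> l + n")
    case False
    with that have "K \<le> i + n" by blast
    then show ?thesis unfolding U_def
      by (subst ord_bound_term[OF c]) (auto simp: K_def N_def)
  qed (simp add: U_def h0)
  have PQ: "dcoeff (P * Q) n $ j = (\<Sum>l\<le>n. \<Sum>i<K. of_nat ((i + (n - l)) choose i) *
      (dcoeff P (i + (n - l)) * fps_nth_deriv i (dcoeff Q l)) $ j)" if "j \<le> m" for n j
  proof -
    have 0: "(of_nat ((i + (n - l)) choose i) * dcoeff P (i + (n - l)) * fps_nth_deriv i (dcoeff Q l)) $ j = 0"
      if "nat (int j + c + 1) \<le> i" for l i j
      using that unfolding mult.assoc fps_of_nat[symmetric] fps_mult_left_const_nth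
      by (subst ord_bound_term[OF c]) auto
    have "(\<Sum>i. of_nat ((i + (n - l)) choose i) * dcoeff P (i + (n - l)) * fps_nth_deriv i (dcoeff Q l)) $ j
        = (\<Sum>i<K. of_nat ((i + (n - l)) choose i) *
            (dcoeff P (i + (n - l)) * fps_nth_deriv i (dcoeff Q l)) $ j)" (is "?L = _") for l
    proof -
      have "?L = (\<Sum>i<nat (int j + c + 1). (of_nat ((i + (n - l)) choose i) * dcoeff P (i + (n - l))
          * fps_nth_deriv i (dcoeff Q l)) $ j)"
        using fps_sums_nth[of "\<lambda>j. nat (int j + c + 1)", OF 0] .
      also have "\<dots> = (\<Sum>i<K. (of_nat ((i + (n - l)) choose i) * dcoeff P (i + (n - l))
          * fps_nth_deriv i (dcoeff Q l)) $ j)"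
        using 0 that by (intro sum.mono_neutral_left) (auto simp: K_def N_def)
      finally show ?thesis
        unfolding mult.assoc fps_of_nat[symmetric] fps_mult_left_const_nth .
    qed
    then show ?thesis unfolding times_dsym.rep_eq fps_sum_nth by (simp only:)
  qed
  have PQh: "(dcoeff (P * Q) n * fps_nth_deriv n h) $ m = (\<Sum>l\<le>n. \<Sum>i<K. U l i (n - l))" for n
  proof -
    have "(dcoeff (P * Q) n * fps_nth_deriv n h) $ m =
      ((\<Sum>l\<le>n. \<Sum>i<K. of_nat ((i + (n - l)) choose i) *
        (dcoeff P (i + (n - l)) * fps_nth_deriv i (dcoeff Q l))) * fps_nth_deriv n h) $ m"
      unfolding fps_mult_nth[of _ "fps_nth_deriv n h"]
      by (intro sum.cong refl arg_cong2[where f = times])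
         (simp add: PQ fps_sum_nth fps_of_nat[symmetric])
    also have "\<dots> = (\<Sum>l\<le>n. \<Sum>i<K. U l i (n - l))"
      unfolding sum_distrib_right fps_sum_nth U_def
      by (intro sum.cong refl) (simp add: mult.assoc fps_of_nat[symmetric])
    finally show ?thesis .
  qed
  define T where "T = (\<Sum>l<N. \<Sum>n<K. \<Sum>i<K. U l i n)"
  have "act (P * Q) h $ m = (\<Sum>n<N. \<Sum>l\<le>n. \<Sum>i<K. U l i (n - l))"
    unfolding PQh[symmetric] by (rule act_nth[OF e]) (simp add: N_def)
  also have "\<dots> = (\<Sum>(l, n)\<in>{(l, n). l + n < N}. \<Sum>i<K. U l i n)"
    by (rule sum.triangle_reindex[symmetric])
  also have "\<dots> = (\<Sum>(l, n)\<in>{..<N} \<times> {..<K}. \<Sum>i<K. U l i n)"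
    by (rule sum.mono_neutral_left) (auto simp: K_def intro!: sum.neutral U0)
  also have "\<dots> = T" unfolding T_def by (rule sum.cartesian_product[symmetric])
  finally have L: "act (P * Q) h $ m = T" .
  define G where "G = (\<Sum>l<N. dcoeff Q l * fps_nth_deriv l h)"
  have Qh: "act Q h = G"
  proof (rule fps_ext)
    fix j
    define M where "M = max N (nat (int j + d + 1))"
    have "act Q h $ j = (\<Sum>l<M. (dcoeff Q l * fps_nth_deriv l h) $ j)"
      by (rule act_nth[OF d]) (simp add: M_def)
    also have "\<dots> = (\<Sum>l<N. (dcoeff Q l * fps_nth_deriv l h) $ j)"
      by (rule sum.mono_neutral_right) (auto simp: M_def h0)
    finally show "act Q h $ j = G $ j" by (simp add: G_def fps_sum_nth)
  qed
  have nd_add: "fps_nth_deriv a (fps_nth_deriv b h) = fps_nth_deriv (b + a) h" for a b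
    by (induction b arbitrary: h) auto
  have "act P G $ m = (\<Sum>k<K. (dcoeff P k * fps_nth_deriv k G) $ m)"
    by (rule act_nth[OF c]) (simp add: K_def N_def)
  also have "\<dots> = (\<Sum>k<K. \<Sum>l<N. \<Sum>i\<le>k. U l i (k - i))"
    unfolding G_def fps_nth_deriv_sum fps_nth_deriv_mult nd_add sum_distrib_left fps_sum_nth U_def
    by (intro sum.cong refl) (simp add: mult.left_commute[of _ "fps_const a" for a] fps_of_nat[symmetric])
  also have "\<dots> = (\<Sum>l<N. \<Sum>k<K. \<Sum>i\<le>k. U l i (k - i))" by (rule sum.swap)
  also have "\<dots> = (\<Sum>l<N. \<Sum>(i, n)\<in>{(i, n). i + n < K}. U l i n)"
    by (simp only: sum.triangle_reindex)
  also have "\<dots> = (\<Sum>l<N. \<Sum>(i, n)\<in>{..<K} \<times> {..<K}. U l i n)"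
    by (intro sum.cong refl sum.mono_neutral_left) (auto intro!: U0)
  also have "\<dots> = (\<Sum>l<N. \<Sum>i<K. \<Sum>n<K. U l i n)" by (simp only: sum.cartesian_product)
  also have "\<dots> = T" unfolding T_def by (intro sum.cong refl sum.swap)
  finally have "act P G $ m = T" .
  with L A B Qh show "act (P * Q) f $ m = act P (act Q f) $ m" by simp
qed

instance dsym :: (field_char_0) ring_1
proof
  fix P Q R :: "'a dsym"
  show "P + Q + R = P + (Q + R)" by transfer (simp add: algebra_simps)
  show "P + Q = Q + P" by transfer (simp add: algebra_simps)
  show "0 + P = P" by transfer simp
  show "- P + P = 0" by transfer simp
  show "P - Q = P + - Q" by (simp add: minus_dsym_def)
  show "P * Q * R = P * (Q * R)" by (rule act_faithful) (simp add: act_mult)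
  show "1 * P = P" "P * 1 = P" by (rule act_faithful, simp add: act_mult act_1)+
  show "(P + Q) * R = P * R + Q * R"
    by (rule act_faithful) (simp add: act_mult act_add_left)
  show "P * (Q + R) = P * Q + P * R"
    by (rule act_faithful) (simp add: act_mult act_add_left act_add_right)
  have "dcoeff (0 :: 'a dsym) 0 \<noteq> dcoeff 1 0" by (simp add: zero_dsym.rep_eq one_dsym.rep_eq)
  then show "(0 :: 'a dsym) \<noteq> 1" by metis
qed


section \<open>Order, homogeneous components and coefficient fields\<close>

definition op_ord :: "'a::field_char_0 dsym \<Rightarrow> ereal" where
  "op_ord P = seq_ord (dcoeff P)"

text \<open>The order as an integer; the value for \<open>P = 0\<close>, where \<^term>\<open>op_ord P = -\<infinity>\<close>, is junk.\<close>

definition int_ord :: "'a::field_char_0 dsym \<Rightarrow> int" where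
  "int_ord P = \<lfloor>real_of_ereal (op_ord P)\<rfloor>"

lift_definition hcomp :: "'a::field_char_0 dsym \<Rightarrow> int \<Rightarrow> 'a dsym" is
  "\<lambda>a t i. Abs_fps (\<lambda>j. if int i - int j = t then a i $ j else 0)"
  by (rule seq_ord_finiteI) auto

definition symb :: "'a::field_char_0 dsym \<Rightarrow> 'a dsym" where
  "symb P = hcomp P (int_ord P)"

definition subfield_set :: "'a::field set \<Rightarrow> bool" where
  "subfield_set K \<longleftrightarrow> 0 \<in> K \<and> 1 \<in> K \<and>
     (\<forall>a\<in>K. \<forall>b\<in>K. a + b \<in> K \<and> a * b \<in> K) \<and> (\<forall>a\<in>K. - a \<in> K \<and> inverse a \<in> K)"

definition adjoin :: "'a::field set \<Rightarrow> 'a \<Rightarrow> 'a set" where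
  "adjoin K \<xi> = {poly p \<xi> | p. \<forall>n. coeff p n \<in> K}"

definition primitive_root_of_unity :: "nat \<Rightarrow> 'a::field \<Rightarrow> bool" where
  "primitive_root_of_unity q \<xi> \<longleftrightarrow> q > 0 \<and> \<xi> ^ q = 1 \<and> (\<forall>m. 0 < m \<and> m < q \<longrightarrow> \<xi> ^ m \<noteq> 1)"

text \<open>The type \<^typ>\<open>'a dsym\<close> has coefficients in the whole field \<^typ>\<open>'a\<close>; the operators over a
  subfield \<open>K\<close> form a subring.\<close>

definition Dsym :: "'a::field_char_0 set \<Rightarrow> 'a dsym set" where
  "Dsym K = {P. \<forall>k m. dcoeff P k $ m \<in> K}"

definition D1 :: "'a::field_char_0 set \<Rightarrow> 'a dsym set" where
  "D1 K = {P \<in> Dsym K. finite {k. dcoeff P k \<noteq> 0}}"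

definition op_deg :: "'a::field_char_0 dsym \<Rightarrow> nat" where
  "op_deg P = Max {k. dcoeff P k \<noteq> 0}"

section \<open>The operators occurring in homogeneous canonical polynomials\<close>

lift_definition of_fps :: "'a::field_char_0 fps \<Rightarrow> 'a dsym" is "\<lambda>f k. if k = 0 then f else 0"
  by (rule seq_ord_finiteI[of 0]) auto

lift_definition del_op :: "'a::field_char_0 dsym" is "\<lambda>k. if k = 1 then 1 else 0"
  by (rule seq_ord_finiteI[of 1]) auto

lift_definition delta_op :: "'a::field_char_0 dsym" is
  "\<lambda>n. fps_const ((- 1) ^ n / fact n) * fps_X ^ n"
  by (rule seq_ord_finiteI[of 0]) (simp add: fps_X_power_nth)

lift_definition int_op :: "'a::field_char_0 dsym" is
  "\<lambda>n. fps_const ((- 1) ^ n / fact (n + 1)) * fps_X ^ (n + 1)"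
  by (rule seq_ord_finiteI[of "- 1"]) (simp add: fps_X_power_nth del: power_Suc)

lift_definition A_op :: "'a::field_char_0 \<Rightarrow> nat \<Rightarrow> 'a dsym" is
  "\<lambda>\<xi> i n. fps_const ((\<xi> ^ i - 1) ^ n / fact n) * fps_X ^ n"
  by (rule seq_ord_finiteI[of 0]) (simp add: fps_X_power_nth)

definition B_op :: "nat \<Rightarrow> 'a::field_char_0 dsym" where
  "B_op j = of_fps (fps_const (1 / fact (j - 1)) * fps_X ^ (j - 1)) * delta_op * del_op ^ (j - 1)"

definition D_pow :: "int \<Rightarrow> 'a::field_char_0 dsym" where
  "D_pow r = (if r \<ge> 0 then del_op ^ nat r else int_op ^ nat (- r))"

section \<open>Homogeneous canonical polynomials\<close>

text \<open>\<open>hcp_form \<xi> q f g r H\<close>: \<open>H\<close> has the form of an HCP from \<open>Hcpc(q)\<close> with coefficients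
  \<open>f l i = f\<^sub>l\<^sub>,\<^sub>i\<^sub>;\<^sub>r\<close> and \<open>g j = g\<^sub>j\<^sub>;\<^sub>r\<close>. The coefficient functions are extended by zero outside the
  index range of the sum, so that uniqueness of the form becomes uniqueness of \<open>f\<close> and \<open>g\<close>
  (for \<open>H = 0\<close> the exponent \<open>r\<close> is arbitrary, but \<open>f\<close> and \<open>g\<close> still vanish).\<close>

definition hcp_form ::
  "'a::field_char_0 \<Rightarrow> nat \<Rightarrow> (nat \<Rightarrow> nat \<Rightarrow> 'a) \<Rightarrow> (nat \<Rightarrow> 'a) \<Rightarrow> int \<Rightarrow> 'a dsym \<Rightarrow> bool" where
  "hcp_form \<xi> q f g r H \<longleftrightarrow>
     (\<exists>(d :: nat \<Rightarrow> nat) (N :: nat).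
        (\<forall>l i. i \<ge> q \<or> l > d i \<longrightarrow> f l i = 0) \<and>
        (\<forall>j. j = 0 \<or> j > N \<longrightarrow> g j = 0) \<and>
        (r < 0 \<longrightarrow> (\<forall>j. int j \<le> - r \<longrightarrow> g j = 0)) \<and>
        H = ((\<Sum>i<q. \<Sum>l\<le>d i. of_fps (fps_const (f l i) * fps_X ^ l) * A_op \<xi> i * del_op ^ l)
             + (\<Sum>j\<in>{1..N}. of_fps (fps_const (g j)) * B_op j)) * D_pow r)"

definition is_hcp :: "'a::field_char_0 \<Rightarrow> nat \<Rightarrow> 'a dsym \<Rightarrow> bool" where
  "is_hcp \<xi> q H \<longleftrightarrow> (\<exists>f g r. hcp_form \<xi> q f g r H)"

definition hcp_A_coeff :: "'a::field_char_0 \<Rightarrow> nat \<Rightarrow> 'a dsym \<Rightarrow> nat \<Rightarrow> nat \<Rightarrow> 'a" where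
  "hcp_A_coeff \<xi> q H = (THE f. \<exists>g r. hcp_form \<xi> q f g r H)"

definition hcp_B_coeff :: "'a::field_char_0 \<Rightarrow> nat \<Rightarrow> 'a dsym \<Rightarrow> nat \<Rightarrow> 'a" where
  "hcp_B_coeff \<xi> q H = (THE g. \<exists>f r. hcp_form \<xi> q f g r H)"

text \<open>The supremum of the empty set in \<^typ>\<open>ereal\<close> is \<open>-\<infinity>\<close>.\<close>

definition Sdeg_A :: "'a::field_char_0 \<Rightarrow> nat \<Rightarrow> 'a dsym \<Rightarrow> ereal" where
  "Sdeg_A \<xi> q H = (SUP l\<in>{l. \<exists>i. hcp_A_coeff \<xi> q H l i \<noteq> 0}. ereal (real l))"

definition Sdeg_B :: "'a::field_char_0 \<Rightarrow> nat \<Rightarrow> 'a dsym \<Rightarrow> ereal" where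
  "Sdeg_B \<xi> q H = (SUP j\<in>{j. hcp_B_coeff \<xi> q H j \<noteq> 0}. ereal (real j))"

definition contains_no_A :: "'a::field_char_0 \<Rightarrow> nat \<Rightarrow> 'a dsym \<Rightarrow> bool" where
  "contains_no_A \<xi> q H \<longleftrightarrow> (\<forall>i>0. \<forall>l. hcp_A_coeff \<xi> q H l i = 0)"

definition totally_B_free :: "'a::field_char_0 \<Rightarrow> nat \<Rightarrow> 'a dsym \<Rightarrow> bool" where
  "totally_B_free \<xi> q H \<longleftrightarrow> (\<forall>s. Sdeg_B \<xi> q (H * D_pow s) = - \<infinity>)"

text \<open>For \<open>P = 0\<close> the last conjunct fails, so the junk value of \<^const>\<open>int_ord\<close> is harmless.\<close>

definition condition_A :: "'a::field_char_0 \<Rightarrow> nat \<Rightarrow> nat \<Rightarrow> 'a dsym \<Rightarrow> bool" where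
  "condition_A \<xi> q k P \<longleftrightarrow> q > 1 \<and>
     (\<forall>t. is_hcp \<xi> q (hcomp P t)) \<and>
     (\<forall>t. totally_B_free \<xi> q (hcomp P t)) \<and>
     (\<forall>i::nat. i > 0 \<longrightarrow> Sdeg_A \<xi> q (hcomp P (int_ord P - int i)) < ereal (real (i + k))) \<and>
     contains_no_A \<xi> q (symb P) \<and> Sdeg_A \<xi> q (symb P) = ereal (real k)"

section \<open>Normalized operators and Schur operators\<close>

definition normalized :: "'a::field_char_0 set \<Rightarrow> nat \<Rightarrow> 'a dsym \<Rightarrow> bool" where
  "normalized K q Q \<longleftrightarrow> Q \<in> D1 K \<and>
     (\<exists>c :: nat \<Rightarrow> 'a fps. Q = del_op ^ q + (\<Sum>k<q - 1. of_fps (c k) * del_op ^ k))"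

text \<open>\<open>T\<close> is the inverse of \<open>S\<close> in the ring of operators over \<open>K\<close>.\<close>

definition schur_operator ::
  "'a::field_char_0 set \<Rightarrow> nat \<Rightarrow> 'a dsym \<Rightarrow> 'a dsym \<Rightarrow> 'a dsym \<Rightarrow> bool" where
  "schur_operator K q Q S T \<longleftrightarrow>
     S \<in> Dsym K \<and> T \<in> Dsym K \<and> S * T = 1 \<and> T * S = 1 \<and>
     op_ord S = 0 \<and> T * Q * S = del_op ^ q \<and> hcomp S 0 = 1 \<and> hcomp S (- 1) = 0"

end

theory Submission
  imports Defs
begin

text \<open>In the basis \<open>e\<^sub>n = x\<^sup>n/n!\<close> one has \<open>D\<^sup>r e\<^sub>n = e\<^sub>n\<^sub>-\<^sub>r\<close>, and an operator \<open>P\<close> of order \<open>p\<close> is described by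
  functions \<open>\<phi>\<^sub>a\<close>: the coefficient of \<open>e\<^sub>m\<close> in \<open>P e\<^sub>n\<close> is \<open>\<phi>\<^sub>a(m)\<close> for \<open>n = m + p - a\<close>. The component of
  order \<open>p - a\<close> is an HCP, totally free of \<open>B\<^sub>j\<close> and of degree \<open>Sdeg\<^sub>A \<le> d\<close>, iff \<open>\<phi>\<^sub>a\<close> is polynomial of degree at most
  \<open>d\<close> on each residue class mod \<open>q\<close> and \<open>\<phi>\<^sub>a(m) = 0\<close> whenever \<open>m + p - a < 0\<close>. Hence condition \<open>A\<^sub>q(0)\<close> says that
  \<open>\<phi>\<^sub>0\<close> is a nonzero constant and \<open>deg \<phi>\<^sub>a < a\<close> for \<open>a > 0\<close>, which is stable under products and inverses.
  Comparing coefficients in \<open>Q S = S \<partial>\<^sup>q\<close> expresses \<open>\<sigma>\<^sub>t(m + q) - \<sigma>\<^sub>t(m)\<close>, for the functions \<open>\<sigma>\<^sub>t\<close> of \<open>S\<close>, by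
  \<open>\<sigma>\<^sub>b\<close> with \<open>b \<le> t - 2\<close>, because \<open>Q\<close> has no \<open>\<partial>\<^sup>q\<^sup>-\<^sup>1\<close> term; inductively the right-hand side has degree at
  most \<open>t - 2\<close>, so \<open>\<sigma>\<^sub>t\<close> has degree at most \<open>t - 1\<close>.\<close>

section \<open>Matrix entries in the basis of divided powers\<close>

definition dpow :: "nat \<Rightarrow> 'a::field_char_0 fps" where
  "dpow n = fps_const (1 / fact n) * fps_X ^ n"

text \<open>The factor \<open>fact m\<close> turns the coefficient of \<open>x^m\<close> into the
  coordinate along \<open>dpow m\<close>.\<close>

definition entry :: "'a::field_char_0 dsym \<Rightarrow> nat \<Rightarrow> nat \<Rightarrow> 'a" where
  "entry P m n = fact m * act P (dpow n) $ m"

lemma dpow_nth: "dpow n $ m = (if m = n then 1 / fact n else 0)"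
  by (simp add: dpow_def fps_X_power_nth)

lemma fps_deriv_dpow: "fps_deriv (dpow n) = (if n = 0 then 0 else dpow (n - 1))"
  by (rule fps_ext) (auto simp: dpow_nth fact_reduce field_simps)

lemma fps_nth_deriv_dpow: "fps_nth_deriv k (dpow n) = (if k \<le> n then dpow (n - k) else 0)"
proof (induction k arbitrary: n)
  case (Suc k)
  then show ?case by (cases n) (auto simp: fps_deriv_dpow)
qed simp

lemma act_scale: "act P (fps_const c * f) = fps_const c * act P f"
proof (rule fps_ext)
  fix m
  obtain d where d: "ord_bound P d" by (rule ord_boundE)
  show "act P (fps_const c * f) $ m = (fps_const c * act P f) $ m"
    by (simp add: act_nth[OF d order_refl] sum_distrib_left mult.left_commute[of _ "fps_const c"])
qed

lemma act_zero_right: "act P 0 = 0"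
  using act_scale[of P 0 0] by simp

lemma act_sum_right: "act P (\<Sum>k\<in>A. f k) = (\<Sum>k\<in>A. act P (f k))"
  by (induction A rule: infinite_finite_induct) (auto simp: act_zero_right act_add_right)

lemma act_zero_left: "act 0 f = 0"
  by (rule fps_ext) (simp add: act_def zero_dsym.rep_eq)

lemma act_sum_left: "act (\<Sum>k\<in>A. P k) f = (\<Sum>k\<in>A. act (P k) f)"
  by (induction A rule: infinite_finite_induct) (auto simp: act_zero_left act_add_left)

text \<open>\<open>\<partial>^k\<close> sends \<open>dpow n\<close> to \<open>dpow (n - k)\<close>
  and kills it for \<open>k > n\<close>, so the series for the action stops at
  \<open>k = n\<close>.\<close>

lemma entry_eq:
  "entry P m n = (\<Sum>k\<le>n. if n \<le> m + k then fact m / fact (n - k) * dcoeff P k $ (m + k - n) else 0)"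
proof -
  obtain c where c: "ord_bound P c" by (rule ord_boundE)
  define K where "K = max (Suc n) (nat (int m + c + 1))"
  have "act P (dpow n) $ m = (\<Sum>k<K. (dcoeff P k * fps_nth_deriv k (dpow n)) $ m)"
    by (rule act_nth[OF c]) (simp add: K_def)
  also have "\<dots> = (\<Sum>k<Suc n. (dcoeff P k * fps_nth_deriv k (dpow n)) $ m)"
    by (rule sum.mono_neutral_right) (auto simp: K_def fps_nth_deriv_dpow)
  also have "\<dots> = (\<Sum>k\<le>n. if n \<le> m + k then dcoeff P k $ (m + k - n) / fact (n - k) else 0)"
  proof (unfold lessThan_Suc_atMost, rule sum.cong[OF refl])
    fix k assume "k \<in> {..n}"
    then have k: "k \<le> n" by simp
    have "(dcoeff P k * fps_nth_deriv k (dpow n)) $ m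
        = fps_const (1 / fact (n - k)) $ 0 * (dcoeff P k * fps_X ^ (n - k)) $ m"
      unfolding fps_nth_deriv_dpow if_P[OF k] unfolding dpow_def
      by (simp add: mult.left_commute[of _ "fps_const _"])
    also have "\<dots> = (if n \<le> m + k then dcoeff P k $ (m + k - n) / fact (n - k) else 0)"
      using k by (auto simp: fps_X_power_mult_right_nth le_diff_conv not_less intro!: arg_cong2[where f = fps_nth])
    finally show "(dcoeff P k * fps_nth_deriv k (dpow n)) $ m
      = (if n \<le> m + k then dcoeff P k $ (m + k - n) / fact (n - k) else 0)" .
  qed
  finally show ?thesis
    unfolding entry_def by (auto simp: sum_distrib_left intro!: sum.cong)
qed

text \<open>An operator of order at most \<open>c\<close> reads only the coefficients of
  \<open>f\<close> up to index \<open>m + c\<close>, so \<open>f\<close> may be replaced by a finite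
  combination of divided powers.\<close>

lemma act_entry:
  assumes "ord_bound P c" "int m + c < int N"
  shows "fact m * act P f $ m = (\<Sum>k<N. entry P m k * (fact k * f $ k))"
proof -
  define g where "g = (\<Sum>k<N. fps_const (fact k * f $ k) * dpow k)"
  have "act P f $ m = act P g $ m"
  proof (rule act_cong[OF assms(1)])
    fix j assume "int j \<le> int m + c"
    with assms(2) have "j < N" by linarith
    then show "f $ j = g $ j"
      by (simp add: g_def fps_sum_nth dpow_nth if_distrib[of "(*) _"] cong: if_cong)
  qed
  also have "\<dots> = (\<Sum>k<N. (fact k * f $ k) * act P (dpow k) $ m)"
    by (simp add: g_def act_sum_right act_scale fps_sum_nth)
  finally show ?thesis
    by (simp add: sum_distrib_left entry_def mult_ac)
qed

text \<open>Row \<open>m\<close> of \<open>P\<close> has no entries beyond column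
  \<open>m + c\<close>, so composition is a finite matrix product.\<close>

lemma entry_mult:
  assumes "ord_bound P c" "int m + c < int N"
  shows "entry (P * Q) m n = (\<Sum>k<N. entry P m k * entry Q k n)"
  unfolding entry_def[of "P * Q"] entry_def[of Q] act_mult by (rule act_entry[OF assms])

lemma entry_faithful:
  assumes "\<And>m n. entry P m n = entry Q m n"
  shows "P = Q"
proof (rule act_faithful, rule fps_ext)
  fix f :: "'a fps" and m
  obtain c where c: "ord_bound P c" by (rule ord_boundE)
  obtain d where d: "ord_bound Q d" by (rule ord_boundE)
  define N where "N = nat (int m + \<bar>c\<bar> + \<bar>d\<bar> + 1)"
  have "fact m * act P f $ m = fact m * act Q f $ m"
    using act_entry[OF c, of m N f] act_entry[OF d, of m N f] assms by (simp add: N_def)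
  then show "act P f $ m = act Q f $ m" by simp
qed

lemma entry_add: "entry (P + Q) m n = entry P m n + entry Q m n"
  by (simp add: entry_def act_add_left algebra_simps)

lemma entry_0: "entry 0 m n = 0"
  by (simp add: entry_def act_zero_left)

lemma entry_1: "entry 1 m n = (if m = n then 1 else 0)"
  by (simp add: entry_def act_1 dpow_nth)

lemma entry_hcomp:
  "entry (hcomp P t) m n = (if int n = int m + t then entry P m n else 0)"
  unfolding entry_eq by (auto simp: hcomp.rep_eq intro!: sum.cong sum.neutral)

lemma entry_eq_0:
  assumes "ord_bound P c" "int n > int m + c"
  shows "entry P m n = 0"
  unfolding entry_eq using assms by (auto simp: ord_bound_def intro!: sum.neutral)

lemma hcomp_nth: "dcoeff (hcomp P t) k $ j = (if int k - int j = t then dcoeff P k $ j else 0)"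
  by (simp add: hcomp.rep_eq)

text \<open>From entries to coefficients: each \<open>dcoeff P k $ j\<close> belongs to the
  component of order \<open>k - j\<close>, and the components of order above \<open>c\<close> have
  zero matrix, hence are zero.\<close>

lemma ord_bound_iff_entry:
  "ord_bound P c \<longleftrightarrow> (\<forall>m n. int n > int m + c \<longrightarrow> entry P m n = 0)"
proof
  assume *: "\<forall>m n. int n > int m + c \<longrightarrow> entry P m n = 0"
  have "hcomp P t = 0" if "t > c" for t
    by (rule entry_faithful) (use * that in \<open>auto simp: entry_hcomp entry_0\<close>)
  then show "ord_bound P c"
    unfolding ord_bound_def
    by (metis hcomp_nth zero_dsym.rep_eq fps_zero_nth)
qed (auto intro: entry_eq_0)

lemma op_ord_le_iff: "op_ord P \<le> ereal (real_of_int c) \<longleftrightarrow> ord_bound P c"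
  by (simp add: op_ord_def seq_ord_le_iff ord_bound_def)

text \<open>By \<open>entry_eq\<close>, a nonzero entry in column \<open>m + c\<close> needs a
  nonzero coefficient at some \<open>k - j = c\<close>, so the supremum is attained.\<close>

lemma op_ord_eqI:
  assumes "ord_bound P c" "entry P m n \<noteq> 0" "int n = int m + c"
  shows "op_ord P = ereal (real_of_int c)"
proof (rule antisym)
  show "op_ord P \<le> ereal (real_of_int c)" using assms(1) by (simp add: op_ord_le_iff)
  have "entry P m n = 0" if "\<And>k. n \<le> m + k \<Longrightarrow> dcoeff P k $ (m + k - n) = 0"
    unfolding entry_eq using that by (intro sum.neutral) simp
  with assms(2) obtain k where k: "n \<le> m + k" "dcoeff P k $ (m + k - n) \<noteq> 0" by blast
  from k(2) have "dcoeff P k \<noteq> 0" "subdegree (dcoeff P k) \<le> m + k - n"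
    by (auto intro: subdegree_leI)
  with k(1) assms(3) have "real_of_int c \<le> real k - real (subdegree (dcoeff P k))" by linarith
  then have "ereal (real_of_int c) \<le> ereal (real k) - xval (dcoeff P k)"
    using \<open>dcoeff P k \<noteq> 0\<close> by (simp add: xval_def)
  also have "\<dots> \<le> op_ord P" unfolding op_ord_def seq_ord_def by (rule SUP_upper) simp
  finally show "ereal (real_of_int c) \<le> op_ord P" .
qed

lemma int_ord_eq: "op_ord P = ereal (real_of_int c) \<Longrightarrow> int_ord P = c"
  by (simp add: int_ord_def)

section \<open>The action of the basic operators\<close>

lemma act_of_fps: "act (of_fps f) g = f * g"
proof (rule fps_ext)
  fix m
  have "ord_bound (of_fps f) 0" by (auto simp: ord_bound_def of_fps.rep_eq)
  then have "act (of_fps f) g $ m = (\<Sum>k<Suc m. (dcoeff (of_fps f) k * fps_nth_deriv k g) $ m)"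
    by (rule act_nth) simp
  also have "\<dots> = (\<Sum>k<Suc m. if k = 0 then (f * g) $ m else 0)"
    by (rule sum.cong) (auto simp: of_fps.rep_eq)
  finally show "act (of_fps f) g $ m = (f * g) $ m" by simp
qed

lemma act_del_op: "act del_op g = fps_deriv g"
proof (rule fps_ext)
  fix m
  have "ord_bound (del_op :: 'a dsym) 1" by (auto simp: ord_bound_def del_op.rep_eq)
  then have "act del_op g $ m = (\<Sum>k<Suc (Suc m). (dcoeff del_op k * fps_nth_deriv k g) $ m)"
    by (rule act_nth) simp
  also have "\<dots> = (\<Sum>k<Suc (Suc m). if k = 1 then fps_deriv g $ m else 0)"
    by (rule sum.cong) (auto simp: del_op.rep_eq)
  finally show "act del_op g $ m = fps_deriv g $ m" by simp
qed

lemma act_del_power: "act (del_op ^ k) g = fps_nth_deriv k g"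
  by (induction k arbitrary: g) (auto simp: act_1 act_mult act_del_op power_commutes[symmetric])

lemma act_dpow_eqI:
  assumes "\<And>m. entry P m n = (if m = k then c else 0)"
  shows "act P (dpow n) = fps_const c * dpow k"
proof (rule fps_ext)
  fix m
  have "fact m * act P (dpow n) $ m = fact m * (fps_const c * dpow k) $ m"
    using assms[of m] by (simp add: entry_def dpow_nth)
  then show "act P (dpow n) $ m = (fps_const c * dpow k) $ m" by simp
qed

text \<open>By Taylor expansion such an operator is the dilation taking \<open>f(x)\<close> to
  \<open>f(a x)\<close>; on \<open>x^n\<close> this is the binomial theorem for
  \<open>((a - 1) + 1)^n\<close>. The case \<open>a = \<xi>^i\<close> is \<open>A_op\<close>, and
  \<open>a = 0\<close> is \<open>delta_op\<close>, evaluation at the origin.\<close>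

lemma act_dilation:
  assumes "\<And>k. dcoeff P k = fps_const ((a - 1) ^ k / fact k) * fps_X ^ k"
  shows "act P (dpow n) = fps_const (a ^ n) * dpow n"
proof (rule act_dpow_eqI)
  fix m
  have "entry P m n = (\<Sum>k\<le>n. if m = n then of_nat (n choose k) * (a - 1) ^ k * 1 ^ (n - k) else 0)"
    unfolding entry_eq
    by (intro sum.cong refl) (auto simp: assms fps_X_power_nth binomial_fact)
  also have "\<dots> = (if m = n then ((a - 1) + 1) ^ n else 0)"
    unfolding binomial_ring by simp
  finally show "entry P m n = (if m = n then a ^ n else 0)" by simp
qed

lemma act_A_op: "act (A_op \<xi> i) (dpow n) = fps_const ((\<xi> ^ i) ^ n) * dpow n"
  by (rule act_dilation) (simp add: A_op.rep_eq)

lemma act_delta_op: "act delta_op (dpow n) = fps_const (0 ^ n) * dpow n"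
  by (rule act_dilation) (simp add: delta_op.rep_eq)

text \<open>\<open>int_op\<close> is integration from 0. The coefficient comes down to an
  alternating sum of the binomials \<open>Suc n choose Suc k\<close>, known because the full
  alternating sum is 0.\<close>

lemma act_int_op: "act int_op (dpow n) = (dpow (Suc n) :: 'a::field_char_0 fps)"
proof -
  have "entry (int_op :: 'a dsym) m n = (if m = Suc n then 1 else 0)" for m
  proof -
    have "entry (int_op :: 'a dsym) m n
      = (\<Sum>k\<le>n. if m = Suc n then of_nat (Suc n choose Suc k) * (- 1) ^ k else 0)"
      unfolding entry_eq
      by (intro sum.cong refl)
         (auto simp: int_op.rep_eq fps_X_power_nth binomial_fact simp del: power_Suc binomial_Suc_Suc)
    also have "\<dots> = (if m = Suc n then - (\<Sum>k\<le>n. (- 1) ^ Suc k * of_nat (Suc n choose Suc k)) else 0)"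
      by (simp add: sum_negf mult.commute del: binomial_Suc_Suc)
    also have "(\<Sum>k\<le>n. (- 1 :: 'a) ^ Suc k * of_nat (Suc n choose Suc k)) = - 1"
      using choose_alternating_sum[of "Suc n", where 'a = 'a]
      unfolding sum.atMost_Suc_shift by (simp add: algebra_simps add_eq_0_iff)
    finally show ?thesis by simp
  qed
  from act_dpow_eqI[OF this] show ?thesis by simp
qed

lemma act_int_power: "act (int_op ^ k) (dpow n) = dpow (n + k)"
  by (induction k arbitrary: n) (auto simp: act_1 act_mult act_int_op power_commutes[symmetric])

lemma act_D_pow: "act (D_pow s) (dpow n) = (if int n \<ge> s then dpow (nat (int n - s)) else 0)"
  by (auto simp: D_pow_def act_del_power act_int_power fps_nth_deriv_dpow nat_diff_distrib nat_add_distrib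
      intro!: arg_cong[where f = dpow])

lemma fps_X_power_dpow:
  "l \<le> n \<Longrightarrow> fps_X ^ l * dpow (n - l) = fps_const (fact n / fact (n - l)) * (dpow n :: 'a::field_char_0 fps)"
  by (rule fps_ext) (auto simp: dpow_nth fps_X_power_mult_nth)

text \<open>Lowering by \<open>j - 1\<close> and then evaluating at the origin isolates the
  coordinate along \<open>dpow (j - 1)\<close>, so \<open>B_op j\<close> is the projection onto
  it.\<close>

lemma act_B_op:
  assumes "j \<ge> 1"
  shows "act (B_op j) (dpow n) = (if n = j - 1 then dpow n else 0)"
proof -
  have "fps_const (1 / fact (j - 1)) * fps_X ^ (j - 1) * dpow 0 = (dpow (j - 1) :: 'a fps)"
    by (simp add: dpow_def)
  then show ?thesis
    by (auto simp: B_op_def act_mult act_of_fps act_del_power fps_nth_deriv_dpow act_delta_op act_zero_right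
        zero_power simp flip: mult.assoc)
qed

lemma act_A_term:
  "act (of_fps (fps_const c * fps_X ^ l) * A_op \<xi> i * del_op ^ l) (dpow n) =
    fps_const (if l \<le> n then c * \<xi> ^ (i * (n - l)) * (fact n / fact (n - l)) else 0) * dpow n"
proof (cases "l \<le> n")
  case True
  have "fps_const c * fps_X ^ l * (fps_const b * dpow (n - l))
      = fps_const (c * b * (fact n / fact (n - l))) * dpow n" for b
  proof -
    have "fps_const c * fps_X ^ l * (fps_const b * dpow (n - l))
        = fps_const (c * b) * (fps_X ^ l * dpow (n - l))"
      by (simp add: mult_ac flip: fps_const_mult)
    then show ?thesis unfolding fps_X_power_dpow[OF True] by (simp flip: mult.assoc)
  qed
  with True show ?thesis
    by (simp add: act_mult act_of_fps act_del_power fps_nth_deriv_dpow act_A_op power_mult mult.assoc)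
qed (simp add: act_mult act_del_power fps_nth_deriv_dpow act_zero_right)

section \<open>Homogeneous canonical polynomials as diagonal operators\<close>

definition fin_coeffs :: "nat \<Rightarrow> nat \<Rightarrow> (nat \<Rightarrow> nat \<Rightarrow> 'a::zero) \<Rightarrow> bool" where
  "fin_coeffs q d f \<longleftrightarrow> (\<forall>l i. i \<ge> q \<or> l > d \<longrightarrow> f l i = 0)"

text \<open>The eigenvalue of \<open>\<Sum>\<^sub>i\<^sub>,\<^sub>l f\<^sub>l\<^sub>,\<^sub>i x\<^sup>l A\<^sub>q\<^sub>;\<^sub>i \<partial>\<^sup>l\<close> on \<open>x\<^sup>m\<close>; the terms with \<open>l > m\<close> kill \<open>x\<^sup>m\<close>.\<close>

definition A_value :: "'a::field_char_0 \<Rightarrow> nat \<Rightarrow> (nat \<Rightarrow> nat \<Rightarrow> 'a) \<Rightarrow> nat \<Rightarrow> 'a" where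
  "A_value \<xi> q f m = (\<Sum>i<q. \<Sum>l\<le>m. f l i * \<xi> ^ (i * (m - l)) * (fact m / fact (m - l)))"

lemma fps_const_sum: "fps_const (\<Sum>i\<in>A. c i) = (\<Sum>i\<in>A. fps_const (c i))"
  by (rule fps_ext) (simp add: fps_sum_nth)

text \<open>The bracket of an HCP is diagonal in the basis \<open>dpow n\<close>. As
  \<open>B_op j\<close> projects onto \<open>dpow (j - 1)\<close>, only \<open>j = Suc n\<close>
  survives in the second sum.\<close>

lemma act_hcp:
  assumes f: "\<And>l i. i \<ge> q \<or> l > d i \<Longrightarrow> f l i = 0" and g: "\<And>j. j = 0 \<or> j > N \<Longrightarrow> g j = 0"
  shows "act ((\<Sum>i<q. \<Sum>l\<le>d i. of_fps (fps_const (f l i) * fps_X ^ l) * A_op \<xi> i * del_op ^ l)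
             + (\<Sum>j\<in>{1..N}. of_fps (fps_const (g j)) * B_op j)) (dpow n)
    = fps_const (A_value \<xi> q f n + g (Suc n)) * dpow n"
proof -
  have "(\<Sum>i<q. \<Sum>l\<le>d i. if l \<le> n then f l i * \<xi> ^ (i * (n - l)) * (fact n / fact (n - l)) else 0) = A_value \<xi> q f n"
    unfolding A_value_def
    by (intro sum.cong refl sum.mono_neutral_cong) (auto simp: f)
  moreover have "(\<Sum>i<q. \<Sum>l\<le>d i. act (of_fps (fps_const (f l i) * fps_X ^ l) * A_op \<xi> i * del_op ^ l) (dpow n))
    = fps_const (\<Sum>i<q. \<Sum>l\<le>d i. if l \<le> n then f l i * \<xi> ^ (i * (n - l)) * (fact n / fact (n - l)) else 0) * dpow n"
    unfolding act_A_term by (simp add: fps_const_sum sum_distrib_right)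
  moreover have "(\<Sum>j\<in>{1..N}. act (of_fps (fps_const (g j)) * B_op j) (dpow n))
    = (\<Sum>j\<in>{1..N}. if j = Suc n then fps_const (g (Suc n)) * dpow n else 0)"
    by (rule sum.cong) (auto simp: act_mult act_of_fps act_B_op)
  moreover have "\<dots> = fps_const (g (Suc n)) * dpow n"
    using g by (auto simp: not_le)
  ultimately show ?thesis
    unfolding act_add_left act_sum_left fps_const_add[symmetric] distrib_right by (simp only:)
qed

lemma entry_mult_D_pow:
  "entry (P * D_pow s) m n = (if int n \<ge> s then entry P m (nat (int n - s)) else 0)"
  by (simp add: entry_def act_mult act_D_pow act_zero_right)

text \<open>A diagonal operator times the shift \<open>D_pow r\<close> has its matrix on the
  diagonal \<open>n = m + r\<close>, and matrices determine operators. For \<open>r \<ge> 0\<close>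
  the condition on \<open>j \<le> - r\<close> concerns at most \<open>j = 0\<close>, so no case
  distinction on the sign of \<open>r\<close> remains.\<close>

lemma hcp_form_iff:
  "hcp_form \<xi> q f g r H \<longleftrightarrow> (\<exists>d. fin_coeffs q d f) \<and> g 0 = 0 \<and> (\<exists>N. \<forall>j>N. g j = 0) \<and>
     (\<forall>j. int j \<le> - r \<longrightarrow> g j = 0) \<and>
     (\<forall>m n. entry H m n = (if int n = int m + r then A_value \<xi> q f m + g (Suc m) else 0))"
  (is "?L \<longleftrightarrow> ?R")
proof -
  define X where "X d N = (\<Sum>i<q. \<Sum>l\<le>d i. of_fps (fps_const (f l i) * fps_X ^ l) * A_op \<xi> i * del_op ^ l)
             + (\<Sum>j\<in>{1..N}. of_fps (fps_const (g j)) * B_op j)" for d :: "nat \<Rightarrow> nat" and N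
  have X: "entry (X d N * D_pow r) m n = (if int n = int m + r then A_value \<xi> q f m + g (Suc m) else 0)"
    if "\<And>l i. i \<ge> q \<or> l > d i \<Longrightarrow> f l i = 0" "\<And>j. j = 0 \<or> j > N \<Longrightarrow> g j = 0" for d N m n
    unfolding entry_mult_D_pow unfolding entry_def X_def
    by (subst act_hcp[where d = d and N = N and f = f and g = g, OF that]) (auto simp: dpow_nth)
  show ?thesis
  proof
    assume ?L
    then obtain d N where d: "\<And>l i. i \<ge> q \<or> l > d i \<Longrightarrow> f l i = 0"
      and N: "\<And>j. j = 0 \<or> j > N \<Longrightarrow> g j = 0"
      and r: "r < 0 \<longrightarrow> (\<forall>j. int j \<le> - r \<longrightarrow> g j = 0)" and H: "H = X d N * D_pow r"
      unfolding hcp_form_def X_def by blast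
    have "fin_coeffs q (Max (insert 0 (d ` {..<q}))) f"
      unfolding fin_coeffs_def
    proof (intro allI impI)
      fix l i assume li: "q \<le> i \<or> Max (insert 0 (d ` {..<q})) < l"
      show "f l i = 0"
      proof (cases "q \<le> i")
        case False
        then have "d i \<le> Max (insert 0 (d ` {..<q}))" by (intro Max_ge) auto
        with False li show ?thesis by (intro d) auto
      qed (simp add: d)
    qed
    then have "\<exists>d. fin_coeffs q d f" by blast
    moreover have "int j \<le> - r \<Longrightarrow> g j = 0" for j
      using r N[of j] by (cases "r < 0") auto
    moreover have "g 0 = 0" "\<exists>N. \<forall>j>N. g j = 0" using N by blast+
    moreover have "entry H m n = (if int n = int m + r then A_value \<xi> q f m + g (Suc m) else 0)" for m n
      unfolding H by (rule X[OF d N])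
    ultimately show ?R by (intro conjI allI impI)
  next
    assume R: ?R
    then obtain d N where d: "fin_coeffs q d f" and N: "\<And>j. j = 0 \<or> j > N \<Longrightarrow> g j = 0" by blast
    have "H = X (\<lambda>_. d) N * D_pow r"
      by (rule entry_faithful, subst X) (use d N R in \<open>auto simp: fin_coeffs_def\<close>)
    then show ?L
      unfolding hcp_form_def X_def
      by (intro exI[of _ "\<lambda>_. d"] exI[of _ N] conjI) (use d N R in \<open>auto simp: fin_coeffs_def\<close>)
  qed
qed

section \<open>Quasi-polynomials\<close>

text \<open>The falling factorial \<open>X (X - 1) ... (X - l + 1)\<close>: its value at
  \<open>m\<close> is the eigenvalue of \<open>x^l \<partial>^l\<close> on
  \<open>x^m\<close>.\<close>

definition ffpoly :: "nat \<Rightarrow> 'a::field_char_0 poly" where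
  "ffpoly l = (\<Prod>j<l. [:- of_nat j, 1:])"

lemma ffpoly_Suc: "ffpoly (Suc l) = ffpoly l * [:- of_nat l, 1:]"
  by (simp add: ffpoly_def)

lemma ffpoly_0: "ffpoly 0 = 1"
  by (simp add: ffpoly_def)

lemma degree_ffpoly: "degree (ffpoly l :: 'a::field_char_0 poly) = l"
  and lead_coeff_ffpoly: "coeff (ffpoly l :: 'a poly) l = 1"
proof -
  have "degree (ffpoly l :: 'a poly) = l \<and> lead_coeff (ffpoly l :: 'a poly) = 1"
  proof (induction l)
    case (Suc l)
    then have "ffpoly l \<noteq> (0 :: 'a poly)" by auto
    with Suc show ?case
      unfolding ffpoly_Suc by (subst degree_mult_eq) (auto simp: lead_coeff_mult simp del: mult_pCons_right)
  qed (simp add: ffpoly_0)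
  then show "degree (ffpoly l :: 'a poly) = l" "coeff (ffpoly l :: 'a poly) l = 1" by auto
qed

lemma poly_ffpoly:
  "poly (ffpoly l) (of_nat m :: 'a::field_char_0) = (if l \<le> m then fact m / fact (m - l) else 0)"
proof (induction l)
  case (Suc l)
  show ?case
  proof (cases "Suc l \<le> m")
    case True
    then have "m - l = Suc (m - Suc l)" "(of_nat (m - l) :: 'a) = of_nat m - of_nat l"
      by (auto simp: of_nat_diff)
    then have "fact (m - l) = (of_nat m - of_nat l) * (fact (m - Suc l) :: 'a)"
      by (metis fact_Suc)
    moreover have "(of_nat m - of_nat l :: 'a) \<noteq> 0" using True by (simp flip: of_nat_diff)
    moreover have "poly (ffpoly (Suc l)) (of_nat m :: 'a) = poly (ffpoly l) (of_nat m) * (of_nat m - of_nat l)"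
      by (simp only: ffpoly_Suc poly_mult) simp
    ultimately show ?thesis using True Suc by (simp del: of_nat_diff)
  next
    case False
    then have "m < l \<or> m = l" by linarith
    then show ?thesis using Suc by (auto simp: ffpoly_Suc)
  qed
qed (simp add: ffpoly_0)

lemma ffpoly_expansion:
  fixes p :: "'a::field_char_0 poly"
  assumes "degree p \<le> d"
  shows "\<exists>c. p = (\<Sum>l\<le>d. smult (c l) (ffpoly l))"
  using assms
proof (induction d arbitrary: p)
  case 0
  then obtain a where "p = [:a:]" by (metis degree_eq_zeroE le_zero_eq)
  then show ?case by (intro exI[of _ "\<lambda>_. a"]) (simp add: ffpoly_0)
next
  case (Suc d)
  define r where "r = p - smult (coeff p (Suc d)) (ffpoly (Suc d))"
  have "degree r \<le> d"
  proof (rule degree_le, intro allI impI)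
    fix i assume "d < i"
    then consider "i = Suc d" | "Suc d < i" by linarith
    then show "coeff r i = 0"
      using Suc.prems by cases (auto simp: r_def lead_coeff_ffpoly coeff_eq_0 degree_ffpoly)
  qed
  from Suc.IH[OF this] obtain c where c: "r = (\<Sum>l\<le>d. smult (c l) (ffpoly l))" by blast
  have "p = (\<Sum>l\<le>Suc d. smult ((c(Suc d := coeff p (Suc d))) l) (ffpoly l))"
    using c[symmetric] by (simp add: r_def)
  then show ?case by blast
qed

lemma ffpoly_independent:
  assumes "(\<Sum>l\<le>d. smult (c l) (ffpoly l)) = (0 :: 'a::field_char_0 poly)" "l \<le> d"
  shows "c l = 0"
  using assms
proof (induction d)
  case (Suc d)
  have "coeff (\<Sum>l\<le>d. smult (c l) (ffpoly l)) (Suc d) = 0"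
    by (simp add: coeff_sum coeff_eq_0 degree_ffpoly)
  with Suc.prems(1) have "c (Suc d) = 0"
    using arg_cong[OF Suc.prems(1), of "\<lambda>p. coeff p (Suc d)"]
    unfolding sum.atMost_Suc coeff_add by (simp add: lead_coeff_ffpoly)
  with Suc show ?case by (cases "l = Suc d") auto
qed (simp add: ffpoly_0)

text \<open>In exponents modulo \<open>q\<close> the number \<open>q - 1\<close> plays the role of
  \<open>-1\<close>, which keeps them natural. The sum is geometric with ratio
  \<open>\<xi>^(i - j)\<close>.\<close>

lemma root_of_unity_orthogonality:
  fixes \<xi> :: "'a::field_char_0"
  assumes \<xi>: "primitive_root_of_unity q \<xi>" and ij: "i < q" "j < q"
  shows "(\<Sum>r<q. \<xi> ^ ((i + (q - 1) * j) * r)) = (if i = j then of_nat q else 0)"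
proof -
  have q: "q > 0" "\<xi> ^ q = 1" and min: "\<And>m. 0 < m \<Longrightarrow> m < q \<Longrightarrow> \<xi> ^ m \<noteq> 1"
    using \<xi> by (auto simp: primitive_root_of_unity_def)
  define z where "z = \<xi> ^ (i + (q - 1) * j)"
  have zq: "z ^ q = 1"
    by (simp add: z_def power_mult[symmetric] mult.commute[of _ q]) (simp add: power_mult q)
  have red: "z * \<xi> ^ j = \<xi> ^ i"
  proof -
    have "i + (q - 1) * j + j = i + q * j"
      using q(1) by (cases q) auto
    then have "z * \<xi> ^ j = \<xi> ^ (i + q * j)" unfolding z_def by (metis power_add)
    then show ?thesis by (simp add: power_add power_mult q)
  qed
  have sum: "(\<Sum>r<q. \<xi> ^ ((i + (q - 1) * j) * r)) = (\<Sum>r<q. z ^ r)"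
    by (simp add: z_def power_mult)
  show ?thesis
  proof (cases "i = j")
    case True
    have "\<xi> \<noteq> 0" using q by (auto simp: power_0_left)
    with red True have "z = 1" by simp
    with sum True show ?thesis by simp
  next
    case False
    have "\<xi> \<noteq> 0" using q by (auto simp: power_0_left)
    have "\<xi> ^ i \<noteq> \<xi> ^ j"
    proof (cases "i < j")
      case True
      then have "\<xi> ^ j = \<xi> ^ i * \<xi> ^ (j - i)" by (simp flip: power_add)
      with min[of "j - i"] True ij \<open>\<xi> \<noteq> 0\<close> show ?thesis by auto
    next
      case False
      with \<open>i \<noteq> j\<close> have "j < i" by simp
      then have "\<xi> ^ i = \<xi> ^ j * \<xi> ^ (i - j)" by (simp flip: power_add)
      with min[of "i - j"] \<open>j < i\<close> ij \<open>\<xi> \<noteq> 0\<close> show ?thesis by auto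
    qed
    with red have "z \<noteq> 1" by auto
    then have "(\<Sum>r<q. z ^ r) = 0" by (subst geometric_sum) (auto simp: zq)
    with sum False show ?thesis by simp
  qed
qed

text \<open>On the class of \<open>r\<close> modulo \<open>q\<close> the power
  \<open>\<xi>^(i (m - l))\<close> is constant; \<open>r + (q - 1) * l\<close> is
  \<open>r - l\<close> modulo \<open>q\<close>. Each class thus gets one polynomial, written in
  falling factorials.\<close>

definition class_poly :: "'a::field_char_0 \<Rightarrow> nat \<Rightarrow> nat \<Rightarrow> (nat \<Rightarrow> nat \<Rightarrow> 'a) \<Rightarrow> nat \<Rightarrow> 'a poly" where
  "class_poly \<xi> q d f r = (\<Sum>l\<le>d. smult (\<Sum>i<q. f l i * \<xi> ^ (i * (r + (q - 1) * l))) (ffpoly l))"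

lemma A_value_class_poly:
  fixes \<xi> :: "'a::field_char_0"
  assumes "\<xi> ^ q = 1" "q > 0" "fin_coeffs q d f"
  shows "A_value \<xi> q f m = poly (class_poly \<xi> q d f (m mod q)) (of_nat m)"
proof -
  have e: "\<xi> ^ (i * (m mod q + (q - 1) * l)) = \<xi> ^ (i * (m - l))" if "l \<le> m" for i l
  proof -
    have "m mod q + (q - 1) * l + q * (m div q) = (m - l) + q * l"
      using that assms(2) div_mult_mod_eq[of m q] by (cases q) (auto simp: algebra_simps)
    then have "i * (m mod q + (q - 1) * l) + q * (i * (m div q)) = i * (m - l) + q * (i * l)"
      by (metis distrib_left mult.left_commute)
    then have "\<xi> ^ (i * (m mod q + (q - 1) * l)) * \<xi> ^ (q * (i * (m div q)))
        = \<xi> ^ (i * (m - l)) * \<xi> ^ (q * (i * l))"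
      by (metis power_add)
    then show ?thesis by (simp add: power_mult[of _ q] assms(1))
  qed
  have "poly (class_poly \<xi> q d f (m mod q)) (of_nat m)
      = (\<Sum>l\<le>d. \<Sum>i<q. if l \<le> m then f l i * \<xi> ^ (i * (m - l)) * (fact m / fact (m - l)) else 0)"
    by (auto simp: class_poly_def poly_sum poly_ffpoly sum_distrib_right e simp del: One_nat_def intro!: sum.cong)
  also have "\<dots> = (\<Sum>i<q. \<Sum>l\<le>d. if l \<le> m then f l i * \<xi> ^ (i * (m - l)) * (fact m / fact (m - l)) else 0)"
    by (rule sum.swap)
  also have "\<dots> = A_value \<xi> q f m"
    unfolding A_value_def using assms(3)
    by (intro sum.cong refl sum.mono_neutral_cong) (auto simp: fin_coeffs_def)
  finally show ?thesis by simp
qed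

text \<open>Every class polynomial has infinitely many roots, hence is zero. Independence of the
  falling factorials leaves, for each \<open>l\<close>, a linear system in the \<open>f l i\<close>
  that Fourier inversion modulo \<open>q\<close> solves.\<close>

lemma A_value_eventually_0:
  fixes \<xi> :: "'a::field_char_0"
  assumes \<xi>: "primitive_root_of_unity q \<xi>" and f: "fin_coeffs q d f"
    and 0: "\<And>m. m \<ge> M \<Longrightarrow> A_value \<xi> q f m = 0"
  shows "f = (\<lambda>_ _. 0)"
proof (intro ext)
  fix l j
  have q: "q > 0" "\<xi> ^ q = 1" using \<xi> by (auto simp: primitive_root_of_unity_def)
  show "f l j = 0"
  proof (cases "j < q \<and> l \<le> d")
    case True
    have "(\<Sum>i<q. f l i * \<xi> ^ (i * (r + (q - 1) * l))) = 0" if "r < q" for r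
    proof -
      have "class_poly \<xi> q d f r = 0"
      proof (rule ccontr)
        assume "class_poly \<xi> q d f r \<noteq> 0"
        then have "finite {x. poly (class_poly \<xi> q d f r) x = 0}" by (rule poly_roots_finite)
        moreover have "(\<lambda>k. of_nat (r + q * k)) ` {M..} \<subseteq> {x. poly (class_poly \<xi> q d f r) x = 0}"
        proof clarify
          fix k assume "M \<le> k"
          have "k \<le> q * k" using q(1) by simp
          with \<open>M \<le> k\<close> have "M \<le> r + q * k" by linarith
          from 0[OF this] that
          show "poly (class_poly \<xi> q d f r) (of_nat (r + q * k)) = 0"
            unfolding A_value_class_poly[OF q(2,1) f] by simp
        qed
        ultimately have "finite ((\<lambda>k. of_nat (r + q * k) :: 'a) ` {M..})" by (rule rev_finite_subset)
        moreover have "inj_on (\<lambda>k. of_nat (r + q * k) :: 'a) {M..}"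
          using q(1) unfolding inj_on_def of_nat_eq_iff by simp
        ultimately show False using infinite_Ici finite_image_iff by blast
      qed
      from ffpoly_independent[OF this[unfolded class_poly_def]] True show ?thesis by blast
    qed
    \<comment> \<open>Multiplying by \<open>\<xi>^(- j r)\<close> and summing over \<open>r\<close>
      isolates the index \<open>i = j\<close>.\<close>
    then have "0 = (\<Sum>r<q. \<xi> ^ (((q - 1) * j) * r) * (\<Sum>i<q. f l i * \<xi> ^ (i * (r + (q - 1) * l))))"
      by simp
    also have "\<dots> = (\<Sum>i<q. \<Sum>r<q. f l i * \<xi> ^ (i * (q - 1) * l) * \<xi> ^ ((i + (q - 1) * j) * r))"
      unfolding sum_distrib_left
      by (subst sum.swap) (intro sum.cong refl, simp add: distrib_left distrib_right power_add mult_ac)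
    also have "\<dots> = (\<Sum>i<q. if i = j then f l i * \<xi> ^ (i * (q - 1) * l) * of_nat q else 0)"
      using True by (intro sum.cong refl) (simp add: root_of_unity_orthogonality[OF \<xi>] del: One_nat_def flip: sum_distrib_left)
    also have "\<dots> = f l j * \<xi> ^ (j * (q - 1) * l) * of_nat q" using True by simp
    finally show ?thesis using q by (auto simp: power_0_left)
  qed (use f in \<open>auto simp: fin_coeffs_def\<close>)
qed

lemma A_value_surj:
  fixes \<xi> :: "'a::field_char_0"
  assumes \<xi>: "primitive_root_of_unity q \<xi>" and p: "\<And>r. degree (p r) \<le> d"
  shows "\<exists>f. fin_coeffs q d f \<and> (\<forall>m. A_value \<xi> q f m = poly (p (m mod q)) (of_nat m))"
proof -
  have q: "q > 0" "\<xi> ^ q = 1" using \<xi> by (auto simp: primitive_root_of_unity_def)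
  obtain c where c: "\<And>r. p r = (\<Sum>l\<le>d. smult (c r l) (ffpoly l))"
    using ffpoly_expansion[OF p] by metis
  \<comment> \<open>The inverse Fourier transform of the coefficients \<open>c s l\<close>; the
    exponent is \<open>- i (s - l)\<close> modulo \<open>q\<close>.\<close>
  define f where "f l i = (if i < q \<and> l \<le> d
    then (\<Sum>s<q. c s l * \<xi> ^ (i * (q - 1) * (s + (q - 1) * l))) / of_nat q else 0)" for l i
  have fin: "fin_coeffs q d f" by (auto simp: fin_coeffs_def f_def)
  have "(\<Sum>i<q. f l i * \<xi> ^ (i * (r + (q - 1) * l))) = c r l" if "r < q" "l \<le> d" for r l
  proof -
    have "\<xi> ^ (i * (q - 1) * (s + (q - 1) * l)) * \<xi> ^ (i * (r + (q - 1) * l))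
        = \<xi> ^ ((r + (q - 1) * s) * i)" for i s
    proof -
      have "(q - 1) * (s + (q - 1) * l) + (r + (q - 1) * l) = (r + (q - 1) * s) + q * ((q - 1) * l)"
        using q(1) by (cases q) (auto simp: algebra_simps)
      from arg_cong[OF this, of "\<lambda>k. i * k"]
      have "i * (q - 1) * (s + (q - 1) * l) + i * (r + (q - 1) * l)
          = (r + (q - 1) * s) * i + q * ((q - 1) * l * i)"
        by (simp only: distrib_left distrib_right mult_ac)
      then show ?thesis
        unfolding power_add[symmetric] by (simp add: power_add[of _ _ "q * _"] power_mult[of _ q] q)
    qed
    then have "(\<Sum>i<q. f l i * \<xi> ^ (i * (r + (q - 1) * l)))
        = (\<Sum>i<q. \<Sum>s<q. c s l * \<xi> ^ ((r + (q - 1) * s) * i) / of_nat q)"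
      using that by (simp add: f_def sum_divide_distrib sum_distrib_right mult.assoc)
    also have "\<dots> = (\<Sum>s<q. c s l * (\<Sum>i<q. \<xi> ^ ((r + (q - 1) * s) * i)) / of_nat q)"
      by (subst sum.swap) (simp add: sum_distrib_left sum_divide_distrib)
    also have "\<dots> = (\<Sum>s<q. if s = r then c s l else 0)"
      using that q by (intro sum.cong refl) (simp add: root_of_unity_orthogonality[OF \<xi>] del: One_nat_def)
    also have "\<dots> = c r l" using that by simp
    finally show ?thesis .
  qed
  then have *: "class_poly \<xi> q d f r = p r" if "r < q" for r
    unfolding class_poly_def c using that by (intro sum.cong refl) simp
  have "A_value \<xi> q f m = poly (p (m mod q)) (of_nat m)" for m
    unfolding A_value_class_poly[OF q(2,1) fin] using q(1) by (simp add: *)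
  with fin show ?thesis by blast
qed

section \<open>Uniqueness of the canonical form and total freeness\<close>

lemma A_value_diff: "A_value \<xi> q (\<lambda>l i. f l i - f' l i) m = A_value \<xi> q f m - A_value \<xi> q f' m"
  by (simp add: A_value_def left_diff_distrib diff_divide_distrib sum_subtractf)

lemma A_value_0: "A_value \<xi> q (\<lambda>_ _. 0) m = 0"
  by (simp add: A_value_def)

lemma hcp_form_fin:
  assumes "hcp_form \<xi> q f g r H"
  obtains d N where "fin_coeffs q d f" "\<And>j. j > N \<Longrightarrow> g j = 0"
  using assms unfolding hcp_form_iff by blast

lemma hcp_form_entry:
  "hcp_form \<xi> q f g r H \<Longrightarrow>
    entry H m n = (if int n = int m + r then A_value \<xi> q f m + g (Suc m) else 0)"
  unfolding hcp_form_iff by (elim conjE) (erule allE, erule allE)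

lemma hcp_form_g_0: "hcp_form \<xi> q f g r H \<Longrightarrow> j = 0 \<or> int j \<le> - r \<Longrightarrow> g j = 0"
  unfolding hcp_form_iff by blast

text \<open>For large \<open>m\<close> the \<open>B\<close>-coefficients vanish, so the A-values
  agree eventually and \<open>f = f'\<close>. The remaining entries determine \<open>g\<close>,
  except at \<open>j \<le> - r\<close>, where the column would be negative and the form prescribes
  0.\<close>

lemma hcp_form_unique_aux:
  assumes \<xi>: "primitive_root_of_unity q \<xi>"
    and h: "hcp_form \<xi> q f g r H" "hcp_form \<xi> q f' g' r H"
  shows "f = f' \<and> g = g'"
proof -
  obtain d N where d: "fin_coeffs q d f" and N: "\<And>j. j > N \<Longrightarrow> g j = 0"
    using hcp_form_fin[OF h(1)] by blast
  obtain d' N' where d': "fin_coeffs q d' f'" and N': "\<And>j. j > N' \<Longrightarrow> g' j = 0"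
    using hcp_form_fin[OF h(2)] by blast
  from d d' have fin: "fin_coeffs q (max d d') (\<lambda>l i. f l i - f' l i)"
    by (auto simp: fin_coeffs_def)
  have eq: "A_value \<xi> q f m + g (Suc m) = A_value \<xi> q f' m + g' (Suc m)" if "int m + r \<ge> 0" for m
  proof -
    have "int (nat (int m + r)) = int m + r" using that by simp
    then show ?thesis
      using hcp_form_entry[OF h(1), of m "nat (int m + r)"] hcp_form_entry[OF h(2), of m "nat (int m + r)"]
      by simp
  qed
  have "(\<lambda>l i. f l i - f' l i) = (\<lambda>_ _. 0)"
  proof (rule A_value_eventually_0[OF \<xi> fin])
    fix m assume "N + N' + nat \<bar>r\<bar> \<le> m"
    with eq[of m] N[of "Suc m"] N'[of "Suc m"] show "A_value \<xi> q (\<lambda>l i. f l i - f' l i) m = 0"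
      by (simp add: A_value_diff)
  qed
  then have f: "f = f'" by (simp add: fun_eq_iff)
  moreover have "g j = g' j" for j
  proof (cases "int j \<le> - r \<or> j = 0")
    case True
    then show ?thesis using h[THEN hcp_form_g_0] by metis
  next
    case False
    then obtain m where "j = Suc m" "int m + r \<ge> 0" by (cases j) auto
    with eq[of m] f show ?thesis by simp
  qed
  ultimately show ?thesis by blast
qed

text \<open>Two different exponents put the matrix on disjoint diagonals, so \<open>H = 0\<close>;
  the zero form then has every exponent and can be compared with both.\<close>

lemma hcp_form_unique:
  assumes \<xi>: "primitive_root_of_unity q \<xi>"
    and h: "hcp_form \<xi> q f g r H" "hcp_form \<xi> q f' g' r' H"
  shows "f = f' \<and> g = g'"
proof (cases "r = r'")
  case False
  have "entry H m n = 0" for m n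
    using hcp_form_entry[OF h(1), of m n] hcp_form_entry[OF h(2), of m n] False
    by (cases "int n = int m + r") auto
  then have 0: "hcp_form \<xi> q (\<lambda>_ _. 0) (\<lambda>_. 0) s H" for s
    by (simp add: hcp_form_iff fin_coeffs_def A_value_0)
  from hcp_form_unique_aux[OF \<xi> h(1) 0] hcp_form_unique_aux[OF \<xi> h(2) 0] show ?thesis by simp
qed (use hcp_form_unique_aux[OF \<xi>] h in blast)

lemma hcp_coeff_eq:
  assumes \<xi>: "primitive_root_of_unity q \<xi>" and h: "hcp_form \<xi> q f g r H"
  shows "hcp_A_coeff \<xi> q H = f" "hcp_B_coeff \<xi> q H = g"
proof -
  show "hcp_A_coeff \<xi> q H = f"
    unfolding hcp_A_coeff_def
    by (rule the_equality) (use h in blast, use hcp_form_unique[OF \<xi> h] in blast)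
  show "hcp_B_coeff \<xi> q H = g"
    unfolding hcp_B_coeff_def
    by (rule the_equality) (use h in blast, use hcp_form_unique[OF \<xi> h] in blast)
qed

lemma Sdeg_B_eq_MInf:
  "Sdeg_B \<xi> q H = - \<infinity> \<longleftrightarrow> (\<forall>j. hcp_B_coeff \<xi> q H j = 0)"
  unfolding Sdeg_B_def ereal_infty_less_eq(2)[symmetric] SUP_le_iff by auto

text \<open>The entries of \<open>H * D_pow s\<close> are cut off where \<open>m + t < 0\<close>. As
  the A-values already vanish there, no \<open>B_op\<close> correction arises and the same
  \<open>f\<close> serves for every \<open>s\<close>.\<close>

lemma totally_B_freeI:
  fixes \<xi> :: "'a::field_char_0"
  assumes \<xi>: "primitive_root_of_unity q \<xi>" and f: "fin_coeffs q d f"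
    and H: "\<And>m n. entry H m n = (if int n = int m + t then A_value \<xi> q f m else 0)"
    and 0: "\<And>m. int m + t < 0 \<Longrightarrow> A_value \<xi> q f m = 0"
  shows "is_hcp \<xi> q H" "totally_B_free \<xi> q H" "hcp_A_coeff \<xi> q H = f"
proof -
  have "hcp_form \<xi> q f (\<lambda>_. 0) (t + s) (H * D_pow s)" for s
    using f 0 by (auto simp: hcp_form_iff entry_mult_D_pow H)
  then have "hcp_B_coeff \<xi> q (H * D_pow s) = (\<lambda>_. 0)" for s
    by (rule hcp_coeff_eq(2)[OF \<xi>])
  then show "totally_B_free \<xi> q H"
    unfolding totally_B_free_def Sdeg_B_eq_MInf by simp
  have h: "hcp_form \<xi> q f (\<lambda>_. 0) t H"
    using f by (auto simp: hcp_form_iff H)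
  show "hcp_A_coeff \<xi> q H = f" by (rule hcp_coeff_eq(1)[OF \<xi> h])
  show "is_hcp \<xi> q H" unfolding is_hcp_def using h by blast
qed

lemma totally_B_freeD:
  fixes \<xi> :: "'a::field_char_0"
  assumes \<xi>: "primitive_root_of_unity q \<xi>"
    and hom: "\<And>m n. int n \<noteq> int m + t \<Longrightarrow> entry H m n = 0"
    and hcp: "is_hcp \<xi> q H" and free: "totally_B_free \<xi> q H"
  obtains d f where "fin_coeffs q d f" "hcp_A_coeff \<xi> q H = f"
    "\<And>m n. entry H m n = (if int n = int m + t then A_value \<xi> q f m else 0)"
    "\<And>m. int m + t < 0 \<Longrightarrow> A_value \<xi> q f m = 0"
proof -
  \<comment> \<open>The exponent of the given form can differ from \<open>t\<close> only if
    \<open>H = 0\<close>, and then the zero form with exponent \<open>t\<close> is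
    available.\<close>
  obtain f g where h: "hcp_form \<xi> q f g t H"
  proof -
    obtain f g r where h: "hcp_form \<xi> q f g r H" using hcp by (auto simp: is_hcp_def)
    show ?thesis
    proof (cases "r = t")
      case False
      then have "entry H m n = 0" for m n
        using hcp_form_entry[OF h, of m n] hom[of n m] by (cases "int n = int m + t") auto
      then have "hcp_form \<xi> q (\<lambda>_ _. 0) (\<lambda>_. 0) t H"
        by (simp add: hcp_form_iff fin_coeffs_def A_value_0)
      then show ?thesis by (rule that)
    qed (use h that in blast)
  qed
  obtain d N where d: "fin_coeffs q d f" and N: "\<And>j. j > N \<Longrightarrow> g j = 0"
    using hcp_form_fin[OF h] by blast
  note H = hcp_form_entry[OF h] and g0 = hcp_form_g_0[OF h]
  text \<open>Multiplication by \<open>D\<^sup>s\<close> with \<open>s \<ge> -t\<close> kills \<open>x\<^sup>n\<close> for \<open>n < s\<close>; in the canonical form of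
    \<open>H D\<^sup>s\<close> this forces the \<open>B\<^sub>j\<close> to cancel the values of the \<open>A\<close>-part below \<open>-t\<close>.\<close>
  define s where "s = \<bar>t\<bar>"
  define g' where "g' j = (if j = 0 then 0 else if int j \<le> - t then - A_value \<xi> q f (j - 1) else g j)" for j
  have "hcp_form \<xi> q f g' (t + s) (H * D_pow s)"
    unfolding hcp_form_iff
  proof (intro conjI allI impI)
    show "\<exists>d. fin_coeffs q d f" using d by blast
    show "g' 0 = 0" by (simp add: g'_def)
    show "\<exists>N. \<forall>j>N. g' j = 0"
      using N by (intro exI[of _ "N + nat s"]) (auto simp: g'_def s_def)
    show "g' j = 0" if "int j \<le> - (t + s)" for j
      using that by (auto simp: s_def g'_def)
    show "entry (H * D_pow s) m n = (if int n = int m + (t + s) then A_value \<xi> q f m + g' (Suc m) else 0)" for m n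
      unfolding entry_mult_D_pow H by (auto simp: g'_def s_def)
  qed
  then have "hcp_B_coeff \<xi> q (H * D_pow s) = g'" by (rule hcp_coeff_eq(2)[OF \<xi>])
  then have g': "g' j = 0" for j
    using free by (auto simp: totally_B_free_def Sdeg_B_eq_MInf)
  have g: "g j = 0" for j using g'[of j] g0[of j] by (auto simp: g'_def split: if_splits)
  show ?thesis
  proof (rule that[OF d hcp_coeff_eq(1)[OF \<xi> h]])
    show "A_value \<xi> q f m = 0" if "int m + t < 0" for m
      using g'[of "Suc m"] that by (auto simp: g'_def)
  qed (simp add: H g)
qed

section \<open>Bounds on \<open>Sdeg_A\<close> as vanishing of coefficients\<close>

lemma Sdeg_A_le_iff:
  "Sdeg_A \<xi> q H \<le> ereal (real n) \<longleftrightarrow> (\<forall>l i. l > n \<longrightarrow> hcp_A_coeff \<xi> q H l i = 0)"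
  unfolding Sdeg_A_def SUP_le_iff by (auto simp: not_le[symmetric])

lemma Sdeg_A_less_iff:
  "Sdeg_A \<xi> q H < ereal (real (Suc n)) \<longleftrightarrow> (\<forall>l i. l > n \<longrightarrow> hcp_A_coeff \<xi> q H l i = 0)"
proof
  assume less: "Sdeg_A \<xi> q H < ereal (real (Suc n))"
  have "l \<le> n" if "hcp_A_coeff \<xi> q H l i \<noteq> 0" for l i
  proof -
    have "ereal (real l) \<le> Sdeg_A \<xi> q H"
      unfolding Sdeg_A_def by (rule SUP_upper) (use that in blast)
    from le_less_trans[OF this less] show ?thesis by simp
  qed
  then show "\<forall>l i. l > n \<longrightarrow> hcp_A_coeff \<xi> q H l i = 0" by (metis not_le)
next
  assume "\<forall>l i. l > n \<longrightarrow> hcp_A_coeff \<xi> q H l i = 0"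
  then have "Sdeg_A \<xi> q H \<le> ereal (real n)" by (simp add: Sdeg_A_le_iff)
  also have "\<dots> < ereal (real (Suc n))" by simp
  finally show "Sdeg_A \<xi> q H < ereal (real (Suc n))" .
qed

text \<open>A nonzero coefficient at \<open>l = 0\<close> separates degree 0 from the value
  \<open>- \<infinity>\<close> of the empty supremum.\<close>

lemma Sdeg_A_eq_0_iff:
  "Sdeg_A \<xi> q H = ereal (real 0) \<longleftrightarrow>
    (\<forall>l i. l > 0 \<longrightarrow> hcp_A_coeff \<xi> q H l i = 0) \<and> (\<exists>i. hcp_A_coeff \<xi> q H 0 i \<noteq> 0)"
  (is "?L \<longleftrightarrow> ?A \<and> ?B")
proof
  assume L: ?L
  then have A: ?A using Sdeg_A_le_iff[of \<xi> q H 0] by simp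
  have ?B
  proof (rule ccontr)
    assume "\<not> ?B"
    with A have "hcp_A_coeff \<xi> q H l i = 0" for l i by (cases "l = 0") auto
    then have "{l. \<exists>i. hcp_A_coeff \<xi> q H l i \<noteq> 0} = {}" by simp
    then have "Sdeg_A \<xi> q H = bot" unfolding Sdeg_A_def by (metis SUP_empty)
    with L show False by (simp add: bot_ereal_def)
  qed
  with A show "?A \<and> ?B" by blast
next
  assume AB: "?A \<and> ?B"
  then have "Sdeg_A \<xi> q H \<le> ereal (real 0)" unfolding Sdeg_A_le_iff by blast
  moreover have "ereal (real 0) \<le> Sdeg_A \<xi> q H"
    unfolding Sdeg_A_def by (rule SUP_upper) (use AB in blast)
  ultimately show ?L by (rule antisym)
qed

section \<open>Quasi-polynomials as eigenvalue functions of canonical forms\<close>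

text \<open>The domain is all of the integers although operators only see \<open>m \<ge> 0\<close>:
  products of symbols evaluate at shifted arguments, which may be negative.\<close>

definition quasi_poly :: "nat \<Rightarrow> nat \<Rightarrow> (int \<Rightarrow> 'a::field_char_0) \<Rightarrow> bool" where
  "quasi_poly q d \<phi> \<longleftrightarrow>
    (\<exists>p. (\<forall>r. degree (p r) \<le> d) \<and> (\<forall>m. \<phi> m = poly (p (m mod int q)) (of_int m)))"

lemma quasi_poly_A_value:
  fixes \<xi> :: "'a::field_char_0"
  assumes \<xi>: "primitive_root_of_unity q \<xi>" and f: "fin_coeffs q d f"
  obtains \<phi> where "quasi_poly q d \<phi>" "\<And>m. \<phi> (int m) = A_value \<xi> q f m"
proof -
  have q: "q > 0" "\<xi> ^ q = 1" using \<xi> by (auto simp: primitive_root_of_unity_def)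
  define \<phi> where "\<phi> m = poly (class_poly \<xi> q d f (nat (m mod int q))) (of_int m)" for m :: int
  have "degree (class_poly \<xi> q d f r) \<le> d" for r
    unfolding class_poly_def
    by (rule degree_sum_le) (auto intro: degree_smult_le[THEN order_trans] simp: degree_ffpoly)
  then have "quasi_poly q d \<phi>"
    unfolding quasi_poly_def \<phi>_def by (intro exI[of _ "\<lambda>r. class_poly \<xi> q d f (nat r)"]) simp
  moreover have "\<phi> (int m) = A_value \<xi> q f m" for m
    by (simp add: \<phi>_def A_value_class_poly[OF q(2,1) f] flip: zmod_int)
  ultimately show ?thesis by (rule that)
qed

lemma A_value_of_quasi_poly:
  fixes \<xi> :: "'a::field_char_0"
  assumes \<xi>: "primitive_root_of_unity q \<xi>" and "quasi_poly q d \<phi>"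
  obtains f where "fin_coeffs q d f" "\<And>m. A_value \<xi> q f m = \<phi> (int m)"
proof -
  obtain p where p: "\<And>r. degree (p r) \<le> d" "\<And>m. \<phi> m = poly (p (m mod int q)) (of_int m)"
    using assms(2) by (auto simp: quasi_poly_def)
  from A_value_surj[OF \<xi>, of "\<lambda>r. p (int r)" d] p(1)
  obtain f where "fin_coeffs q d f" "\<And>m. A_value \<xi> q f m = poly (p (int (m mod q))) (of_nat m)"
    by blast
  then show ?thesis using that[of f] p(2) by (simp add: zmod_int)
qed

section \<open>Symbols\<close>

text \<open>\<open>\<phi> a\<close> encodes the homogeneous component of order \<open>p - a\<close>. The vanishing condition is the
  total freeness of \<open>B\<^sub>j\<close>: it says that the component, extended to negative powers of \<open>x\<close> by the same
  formula, maps them to zero.\<close>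

definition has_symbol :: "'a::field_char_0 dsym \<Rightarrow> int \<Rightarrow> (nat \<Rightarrow> int \<Rightarrow> 'a) \<Rightarrow> bool" where
  "has_symbol P p \<phi> \<longleftrightarrow>
    (\<forall>m n. entry P m n = (if int n \<le> int m + p then \<phi> (nat (int m + p - int n)) (int m) else 0)) \<and>
    (\<forall>a m. int m + p < int a \<longrightarrow> \<phi> a (int m) = 0)"

text \<open>The degree conditions of \<open>condition_A\<close> for \<open>k = 0\<close>, read on
  symbols: the constant is a top component in which only \<open>A_op \<xi> 0\<close> and
  \<open>l = 0\<close> occur, and the bound \<open>a\<close> at index \<open>Suc a\<close> is a
  strict inequality.\<close>

definition admissible :: "nat \<Rightarrow> (nat \<Rightarrow> int \<Rightarrow> 'a::field_char_0) \<Rightarrow> bool" where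
  "admissible q \<phi> \<longleftrightarrow> (\<exists>c. c \<noteq> 0 \<and> \<phi> 0 = (\<lambda>_. c)) \<and> (\<forall>a. quasi_poly q a (\<phi> (Suc a)))"

lemma op_ord_has_symbol:
  assumes "has_symbol P p \<phi>" "admissible q \<phi>"
  shows "op_ord P = ereal (real_of_int p)"
proof (rule op_ord_eqI)
  show "ord_bound P p" using assms(1) by (auto simp: ord_bound_iff_entry has_symbol_def)
  \<comment> \<open>For either sign of \<open>p\<close> this position lies on the diagonal
    \<open>n = m + p\<close>.\<close>
  show "entry P (nat (- p)) (nat p) \<noteq> 0"
    using assms by (auto simp: has_symbol_def admissible_def)
qed simp

lemma A_value_const:
  assumes "q > 0"
  shows "A_value \<xi> q (\<lambda>l i. if l = 0 \<and> i = 0 then c else 0) m = c"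
proof -
  have "A_value \<xi> q (\<lambda>l i. if l = 0 \<and> i = 0 then c else 0) m
    = (\<Sum>i<q. \<Sum>l\<le>m. if l = 0 then if i = 0 then c else 0 else 0)"
    unfolding A_value_def by (intro sum.cong) auto
  then show ?thesis using assms by simp
qed

text \<open>By total freeness each component is given by the A-values of its coefficients. These
  extend to quasi-polynomials on the integers, with degrees controlled by the strict bounds on
  \<open>Sdeg_A\<close>.\<close>

lemma condition_A_imp_symbol:
  fixes \<xi> :: "'a::field_char_0"
  assumes \<xi>: "primitive_root_of_unity q \<xi>" and P: "condition_A \<xi> q 0 P"
    and p: "op_ord P = ereal (real_of_int p)"
  obtains \<phi> where "has_symbol P p \<phi>" "admissible q \<phi>"
proof -
  have ip: "int_ord P = p" using p by (rule int_ord_eq)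
  define f where "f t = hcp_A_coeff \<xi> q (hcomp P t)" for t
  have "(\<exists>d. fin_coeffs q d (f t)) \<and> (\<forall>m n. int n = int m + t \<longrightarrow> entry P m n = A_value \<xi> q (f t) m)
    \<and> (\<forall>m. int m + t < 0 \<longrightarrow> A_value \<xi> q (f t) m = 0)" for t
  proof -
    have hom: "entry (hcomp P t) m n = 0" if "int n \<noteq> int m + t" for m n
      using that by (simp add: entry_hcomp)
    have "is_hcp \<xi> q (hcomp P t)" "totally_B_free \<xi> q (hcomp P t)"
      using P by (auto simp: condition_A_def)
    from totally_B_freeD[OF \<xi> hom this] obtain d f'
      where f': "fin_coeffs q d f'" "hcp_A_coeff \<xi> q (hcomp P t) = f'"
        "\<And>m n. entry (hcomp P t) m n = (if int n = int m + t then A_value \<xi> q f' m else 0)"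
        "\<And>m. int m + t < 0 \<Longrightarrow> A_value \<xi> q f' m = 0" by blast
    have "entry P m n = A_value \<xi> q f' m" if "int n = int m + t" for m n
      using f'(3)[of m n] that by (simp add: entry_hcomp)
    with f' show ?thesis unfolding f_def by blast
  qed
  then have fin: "\<And>t. \<exists>d. fin_coeffs q d (f t)"
    and ent: "\<And>t m n. int n = int m + t \<Longrightarrow> entry P m n = A_value \<xi> q (f t) m"
    and van: "\<And>t m. int m + t < 0 \<Longrightarrow> A_value \<xi> q (f t) m = 0" by blast+
  have q: "q > 0" using \<xi> by (simp add: primitive_root_of_unity_def)
  have "fin_coeffs q a (f (p - int (Suc a)))" for a
  proof -
    have "Sdeg_A \<xi> q (hcomp P (p - int (Suc a))) < ereal (real (Suc a))"
      using P unfolding condition_A_def ip by (metis add_0_right zero_less_Suc)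
    then show ?thesis
      unfolding Sdeg_A_less_iff f_def[symmetric]
      using fin[of "p - int (Suc a)"] by (auto simp: fin_coeffs_def)
  qed
  then have "\<exists>\<phi>. quasi_poly q a \<phi> \<and> (\<forall>m. \<phi> (int m) = A_value \<xi> q (f (p - int (Suc a))) m)" for a
    using quasi_poly_A_value[OF \<xi>] by metis
  then obtain \<psi> where \<psi>: "\<And>a. quasi_poly q a (\<psi> a)"
    "\<And>a m. \<psi> a (int m) = A_value \<xi> q (f (p - int (Suc a))) m" by metis
  define c where "c = f p 0 0"
  have sd: "Sdeg_A \<xi> q (hcomp P p) = ereal (real 0)" and no: "contains_no_A \<xi> q (hcomp P p)"
    using P unfolding condition_A_def symb_def ip by auto
  have f1: "f p l i = 0" if "i > 0" for l i
    using no that by (auto simp: contains_no_A_def f_def)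
  have f2: "f p l i = 0" if "l > 0" for l i
    using sd that unfolding Sdeg_A_eq_0_iff f_def by blast
  have f3: "\<exists>i. f p 0 i \<noteq> 0"
    using sd unfolding Sdeg_A_eq_0_iff f_def by blast
  have fp: "f p = (\<lambda>l i. if l = 0 \<and> i = 0 then c else 0)"
    using f1 f2 by (auto simp: fun_eq_iff c_def)
  have "c \<noteq> 0" using f3 fp by auto
  \<comment> \<open>Index 0 gets the constant on all integers, since \<open>admissible\<close> asks
    for constancy at negative arguments too.\<close>
  define \<phi> where "\<phi> a = (case a of 0 \<Rightarrow> (\<lambda>_. c) | Suc a \<Rightarrow> \<psi> a)" for a
  have \<phi>: "\<phi> a (int m) = A_value \<xi> q (f (p - int a)) m" for a m
    by (cases a) (simp_all add: \<phi>_def fp A_value_const[OF q] \<psi>(2))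
  have "entry P m n = (if int n \<le> int m + p then \<phi> (nat (int m + p - int n)) (int m) else 0)" for m n
  proof (cases "int n \<le> int m + p")
    case True
    then show ?thesis unfolding \<phi> by (simp add: ent[of n m "int n - int m"])
  next
    case False
    have "ord_bound P p" using p by (simp flip: op_ord_le_iff)
    with False show ?thesis by (simp add: entry_eq_0)
  qed
  moreover have "\<phi> a (int m) = 0" if "int m + p < int a" for a m
    unfolding \<phi> by (rule van) (use that in simp)
  ultimately have "has_symbol P p \<phi>" unfolding has_symbol_def by blast
  moreover have "admissible q \<phi>"
    using \<open>c \<noteq> 0\<close> \<psi>(1) by (auto simp: admissible_def \<phi>_def)
  ultimately show ?thesis by (rule that)
qed

lemma symbol_imp_condition_A:
  fixes \<xi> :: "'a::field_char_0"
  assumes \<xi>: "primitive_root_of_unity q \<xi>" and "q > 1"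
    and P: "has_symbol P p \<phi>" and \<phi>: "admissible q \<phi>"
  shows "condition_A \<xi> q 0 P"
proof -
  have ip: "int_ord P = p" by (rule int_ord_eq, rule op_ord_has_symbol[OF P \<phi>])
  have H: "is_hcp \<xi> q (hcomp P (p - int a))" "totally_B_free \<xi> q (hcomp P (p - int a))"
    "hcp_A_coeff \<xi> q (hcomp P (p - int a)) = f"
    if "fin_coeffs q d f" "\<And>m. A_value \<xi> q f m = \<phi> a (int m)" for a d f
  proof -
    have van: "A_value \<xi> q f m = 0" if "int m + (p - int a) < 0" for m
      using P that by (simp add: has_symbol_def \<open>\<And>m. A_value \<xi> q f m = \<phi> a (int m)\<close>)
    have "entry (hcomp P (p - int a)) m n = (if int n = int m + (p - int a) then A_value \<xi> q f m else 0)" for m n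
      using P that by (auto simp: entry_hcomp has_symbol_def)
    note * = totally_B_freeI[OF \<xi> that(1) this]
    show "is_hcp \<xi> q (hcomp P (p - int a))" "totally_B_free \<xi> q (hcomp P (p - int a))"
      "hcp_A_coeff \<xi> q (hcomp P (p - int a)) = f"
      by (rule *, rule van, assumption)+
  qed
  obtain c where c: "c \<noteq> 0" "\<phi> 0 = (\<lambda>_. c)" using \<phi> by (auto simp: admissible_def)
  have "fin_coeffs q 0 (\<lambda>l i. if l = 0 \<and> i = 0 then c else 0)"
    using \<open>q > 1\<close> by (simp add: fin_coeffs_def)
  note top = H[OF this, of 0, unfolded A_value_const[OF order.strict_trans[OF zero_less_one \<open>q > 1\<close>]] c(2), OF refl]
  have low: "is_hcp \<xi> q (hcomp P (p - int (Suc a))) \<and> totally_B_free \<xi> q (hcomp P (p - int (Suc a))) \<and>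
    (\<forall>l i. l > a \<longrightarrow> hcp_A_coeff \<xi> q (hcomp P (p - int (Suc a))) l i = 0)" for a
  proof -
    have "quasi_poly q a (\<phi> (Suc a))" using \<phi> by (simp add: admissible_def)
    from A_value_of_quasi_poly[OF \<xi> this] obtain f
      where f: "fin_coeffs q a f" "\<And>m. A_value \<xi> q f m = \<phi> (Suc a) (int m)" by blast
    show ?thesis using H[OF f] f(1) by (auto simp: fin_coeffs_def)
  qed
  have "is_hcp \<xi> q (hcomp P t) \<and> totally_B_free \<xi> q (hcomp P t)" for t
  proof -
    \<comment> \<open>Above the order the component is zero and has the canonical form with zero
      coefficients; the other cases are \<open>top\<close> and \<open>low\<close>.\<close>
    consider "t > p" | "t = p - int 0" | a where "t = p - int (Suc a)"
    proof -
      have "t = p - int (Suc (nat (p - t - 1)))" if "t < p" using that by simp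
      then show ?thesis using that by (metis diff_zero int_ops(1) linorder_neqE)
    qed
    then show ?thesis
    proof cases
      case 1
      have "entry (hcomp P t) m n = (if int n = int m + t then A_value \<xi> q (\<lambda>_ _. 0) m else 0)" for m n
        using P 1 by (simp add: entry_hcomp has_symbol_def A_value_0)
      from totally_B_freeI[OF \<xi> _ this, of 0] show ?thesis
        by (simp add: fin_coeffs_def A_value_0)
    qed (use top low in auto)
  qed
  moreover have "Sdeg_A \<xi> q (hcomp P (p - int i)) < ereal (real (i + 0))" if "i > 0" for i
  proof -
    from that obtain a where "i = Suc a" by (cases i) auto
    then show ?thesis using low[of a] by (simp only: add_0_right Sdeg_A_less_iff) blast
  qed
  moreover have "contains_no_A \<xi> q (symb P)" "Sdeg_A \<xi> q (symb P) = ereal (real 0)"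
    using top(3) c(1) unfolding Sdeg_A_eq_0_iff by (auto simp: symb_def ip contains_no_A_def)
  ultimately show ?thesis using \<open>q > 1\<close> by (simp add: condition_A_def ip)
qed

section \<open>Closure properties of quasi-polynomials\<close>

lemma quasi_poly_mono: "quasi_poly q d \<phi> \<Longrightarrow> d \<le> e \<Longrightarrow> quasi_poly q e \<phi>"
  unfolding quasi_poly_def by (metis order_trans)

lemma quasi_poly_poly: "degree p \<le> d \<Longrightarrow> quasi_poly q d (\<lambda>m. poly p (of_int m))"
  unfolding quasi_poly_def by (intro exI[of _ "\<lambda>_. p"]) simp

lemma quasi_poly_const: "quasi_poly q d (\<lambda>_. c)"
  using quasi_poly_poly[of "[:c:]" d q] by simp

lemma quasi_poly_add:
  assumes "quasi_poly q d \<phi>" "quasi_poly q d \<psi>"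
  shows "quasi_poly q d (\<lambda>m. \<phi> m + \<psi> m)"
proof -
  obtain p p' where "\<And>r. degree (p r) \<le> d" "\<And>m. \<phi> m = poly (p (m mod int q)) (of_int m)"
    "\<And>r. degree (p' r) \<le> d" "\<And>m. \<psi> m = poly (p' (m mod int q)) (of_int m)"
    using assms unfolding quasi_poly_def by blast
  then show ?thesis
    unfolding quasi_poly_def by (intro exI[of _ "\<lambda>r. p r + p' r"]) (simp add: degree_add_le)
qed

lemma quasi_poly_mult:
  assumes "quasi_poly q d \<phi>" "quasi_poly q e \<psi>"
  shows "quasi_poly q (d + e) (\<lambda>m. \<phi> m * \<psi> m)"
proof -
  obtain p p' where "\<And>r. degree (p r) \<le> d" "\<And>m. \<phi> m = poly (p (m mod int q)) (of_int m)"
    "\<And>r. degree (p' r) \<le> e" "\<And>m. \<psi> m = poly (p' (m mod int q)) (of_int m)"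
    using assms unfolding quasi_poly_def by blast
  then show ?thesis
    unfolding quasi_poly_def
    by (intro exI[of _ "\<lambda>r. p r * p' r"]) (auto intro!: order_trans[OF degree_mult_le add_mono])
qed

lemma quasi_poly_uminus: "quasi_poly q d \<phi> \<Longrightarrow> quasi_poly q d (\<lambda>m. - \<phi> m)"
  using quasi_poly_mult[OF quasi_poly_const[of q 0 "- 1"]] by simp

lemma quasi_poly_sum:
  "(\<And>a. a \<in> A \<Longrightarrow> quasi_poly q d (\<phi> a)) \<Longrightarrow> quasi_poly q d (\<lambda>m. \<Sum>a\<in>A. \<phi> a m)"
  by (induction A rule: infinite_finite_induct) (auto intro: quasi_poly_const quasi_poly_add)

text \<open>Shifting the argument by \<open>k\<close> permutes the residue classes: the polynomial
  of class \<open>r + k\<close>, with shifted argument, serves class \<open>r\<close>.\<close>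

lemma quasi_poly_shift:
  assumes "quasi_poly q d \<phi>"
  shows "quasi_poly q d (\<lambda>m. \<phi> (m + k))"
proof -
  obtain p where p: "\<And>r. degree (p r) \<le> d" "\<And>m. \<phi> m = poly (p (m mod int q)) (of_int m)"
    using assms unfolding quasi_poly_def by blast
  have "degree (pcompose (p r) [:of_int k, 1:]) \<le> d" for r
    using p(1)[of r] by (simp add: degree_pcompose)
  moreover have "\<phi> (m + k) = poly (pcompose (p ((m mod int q + k) mod int q)) [:of_int k, 1:]) (of_int m)" for m
    by (simp add: p(2) poly_pcompose mod_add_left_eq add.commute[of "of_int m"])
  ultimately show ?thesis
    unfolding quasi_poly_def
    by (intro exI[of _ "\<lambda>r. pcompose (p ((r + k) mod int q)) [:of_int k, 1:]"]) blast
qed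

section \<open>Difference equations on residue classes\<close>

text \<open>The discrete analogue of differentiating \<open>x^(l + 1)\<close>; it provides
  antidifferences in the falling factorial basis.\<close>

lemma poly_ffpoly_difference:
  "poly (ffpoly (Suc l)) (y + 1) - poly (ffpoly (Suc l)) y = of_nat (Suc l) * poly (ffpoly l) (y :: 'a::field_char_0)"
proof -
  have ff: "poly (ffpoly l) y = (\<Prod>j<l. y - of_nat j)" for l and y :: 'a
    by (simp add: ffpoly_def poly_prod)
  have "poly (ffpoly (Suc l)) (y + 1) = (y + 1) * poly (ffpoly l) y"
    unfolding ff prod.lessThan_Suc_shift by simp
  moreover have "poly (ffpoly (Suc l)) y = poly (ffpoly l) y * (y - of_nat l)"
    unfolding ff by simp
  ultimately show ?thesis by (simp add: algebra_simps)
qed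

text \<open>Substituting \<open>x = c y\<close> turns the step \<open>c\<close> into 1, where
  \<open>ffpoly l\<close> has the antidifference \<open>ffpoly (Suc l)\<close> divided by
  \<open>Suc l\<close>.\<close>

lemma poly_difference_surj:
  fixes p :: "'a::field_char_0 poly"
  assumes "degree p \<le> d" "c \<noteq> 0"
  obtains u where "degree u \<le> Suc d" "\<And>x. poly u (x + c) - poly u x = poly p x"
proof -
  have "degree (pcompose p [:0, c:]) \<le> d" using assms by (simp add: degree_pcompose)
  from ffpoly_expansion[OF this] obtain k
    where k: "pcompose p [:0, c:] = (\<Sum>l\<le>d. smult (k l) (ffpoly l))" by blast
  define v where "v = (\<Sum>l\<le>d. smult (k l / of_nat (Suc l)) (ffpoly (Suc l)))"
  have "degree v \<le> Suc d"
    unfolding v_def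
    by (rule degree_sum_le) (auto intro: degree_smult_le[THEN order_trans] simp: degree_ffpoly)
  then have "degree (pcompose v [:0, 1 / c:]) \<le> Suc d" using assms(2) by (simp add: degree_pcompose)
  moreover have "poly (pcompose v [:0, 1 / c:]) (x + c) - poly (pcompose v [:0, 1 / c:]) x = poly p x" for x
  proof -
    define y where "y = x / c"
    have x: "x = c * y" and y: "(x + c) * (1 / c) = y + 1" "x * (1 / c) = y"
      using assms(2) by (auto simp: y_def field_simps)
    have "poly v (y + 1) - poly v y
      = (\<Sum>l\<le>d. k l / of_nat (Suc l) * (poly (ffpoly (Suc l)) (y + 1) - poly (ffpoly (Suc l)) y))"
      unfolding v_def poly_sum poly_smult right_diff_distrib sum_subtractf ..
    also have "\<dots> = (\<Sum>l\<le>d. k l * poly (ffpoly l) y)"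
      unfolding poly_ffpoly_difference by (intro sum.cong refl) (simp del: of_nat_Suc)
    also have "\<dots> = poly (pcompose p [:0, c:]) y" by (simp add: k poly_sum)
    also have "\<dots> = poly p x" by (simp add: poly_pcompose x mult.commute)
    finally show ?thesis by (simp only: poly_pcompose) (use y in simp)
  qed
  ultimately show ?thesis by (rule that)
qed

text \<open>A step of length \<open>q\<close> stays within its residue class, so each class carries
  a polynomial difference equation, whose solution gains one degree.\<close>

lemma quasi_poly_difference:
  fixes s :: "nat \<Rightarrow> 'a::field_char_0"
  assumes R: "quasi_poly q d R" and "q > 0" and s: "\<And>m. s (m + q) - s m = R (int m)"
  shows "\<exists>\<sigma>. quasi_poly q (Suc d) \<sigma> \<and> (\<forall>m. \<sigma> (int m) = s m)"
proof -
  obtain p where p: "\<And>r. degree (p r) \<le> d" "\<And>m. R m = poly (p (m mod int q)) (of_int m)"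
    using R unfolding quasi_poly_def by blast
  have "(of_nat q :: 'a) \<noteq> 0" using \<open>q > 0\<close> by simp
  then have "\<exists>u. degree u \<le> Suc d \<and> (\<forall>x. poly u (x + of_nat q) - poly u x = poly (p r) x)" for r
    using poly_difference_surj[OF p(1)] by metis
  then obtain u where u: "\<And>r. degree (u r) \<le> Suc d"
    "\<And>r x. poly (u r) (x + of_nat q) - poly (u r) x = poly (p r) x" by metis
  \<comment> \<open>The additive constant on each class is fixed by the initial value of
    \<open>s\<close> at the representative \<open>r < q\<close>.\<close>
  define u' where "u' r = u r + [:s (nat r) - poly (u r) (of_int r):]" for r
  define \<sigma> where "\<sigma> m = poly (u' (m mod int q)) (of_int m)" for m :: int
  have "degree (u' r) \<le> Suc d" for r
    unfolding u'_def using u(1) by (intro degree_add_le) auto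
  then have "quasi_poly q (Suc d) \<sigma>" unfolding quasi_poly_def \<sigma>_def by blast
  moreover have "\<sigma> (int (r + q * k)) = s (r + q * k)" if "r < q" for r k
  proof (induction k)
    case 0
    then show ?case using that by (simp add: \<sigma>_def u'_def flip: zmod_int)
  next
    case (Suc k)
    define m where "m = r + q * k"
    have Suc_m: "r + q * Suc k = m + q" and mr: "m mod q = r" "(m + q) mod q = r"
      using that by (auto simp: m_def)
    have "\<sigma> (int (m + q)) - \<sigma> (int m) = poly (u (int r)) (of_nat m + of_nat q) - poly (u (int r)) (of_nat m)"
      unfolding \<sigma>_def zmod_int[symmetric] mr by (simp add: u'_def)
    also have "\<dots> = R (int m)"
      unfolding u(2) p(2) zmod_int[symmetric] mr by simp
    also have "\<dots> = s (m + q) - s m" by (rule s[symmetric])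
    finally have "\<sigma> (int (m + q)) = s (m + q)" using Suc[folded m_def] by (simp del: of_nat_add)
    then show ?case unfolding Suc_m .
  qed
  then have "\<sigma> (int m) = s m" for m
    using \<open>q > 0\<close> by (metis mod_less_divisor mod_mult_div_eq)
  ultimately show ?thesis by blast
qed

text \<open>Truncated subtraction gives degree 0 both at \<open>a = 0\<close>, where the symbol is
  constant, and at \<open>a = 1\<close>.\<close>

lemma admissible_quasi_poly:
  assumes "admissible q \<phi>"
  shows "quasi_poly q (a - 1) (\<phi> a)"
  using assms by (cases a) (auto simp: admissible_def intro: quasi_poly_const)

section \<open>Composition of symbols\<close>

lemma has_symbol_entry:
  assumes "has_symbol P p \<phi>" "int n = int m + p - int a"
  shows "entry P m n = \<phi> a (int m)"
  using assms by (auto simp: has_symbol_def)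

lemma has_symbol_entry_0:
  "has_symbol P p \<phi> \<Longrightarrow> int n > int m + p \<Longrightarrow> entry P m n = 0"
  by (simp add: has_symbol_def)

lemma has_symbol_vanish:
  "has_symbol P p \<phi> \<Longrightarrow> int m + p < int a \<Longrightarrow> \<phi> a (int m) = 0"
  by (simp add: has_symbol_def)

lemma has_symbol_ord_bound: "has_symbol P p \<phi> \<Longrightarrow> ord_bound P p"
  by (simp add: ord_bound_iff_entry has_symbol_def)

text \<open>The component of the first factor of order \<open>p - a\<close> sends
  \<open>dpow (m + p - a)\<close> to a multiple of \<open>dpow m\<close>, so the second symbol is
  read at \<open>m + (p - a)\<close>.\<close>

definition symbol_mult :: "int \<Rightarrow> (nat \<Rightarrow> int \<Rightarrow> 'a::field_char_0) \<Rightarrow> (nat \<Rightarrow> int \<Rightarrow> 'a) \<Rightarrow> nat \<Rightarrow> int \<Rightarrow> 'a" where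
  "symbol_mult p \<phi> \<psi> t m = (\<Sum>a\<le>t. \<phi> a m * \<psi> (t - a) (m + (p - int a)))"

text \<open>The matrix product runs over intermediate indices \<open>k = m + p - a \<ge> 0\<close>,
  while \<open>symbol_mult\<close> sums over all \<open>a \<le> t\<close>; the vanishing conditions
  account for the difference.\<close>

lemma has_symbol_mult:
  assumes P: "has_symbol P p \<phi>" and Q: "has_symbol Q p' \<psi>"
  shows "has_symbol (P * Q) (p + p') (symbol_mult p \<phi> \<psi>)"
  unfolding has_symbol_def
proof (intro conjI allI impI)
  fix m n
  define N where "N = nat (int m + p + 1)"
  have PQ: "entry (P * Q) m n = (\<Sum>k<N. entry P m k * entry Q k n)"
    by (rule entry_mult[OF has_symbol_ord_bound[OF P]]) (simp add: N_def)
  show "entry (P * Q) m n = (if int n \<le> int m + (p + p')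
    then symbol_mult p \<phi> \<psi> (nat (int m + (p + p') - int n)) (int m) else 0)"
  proof (cases "int n \<le> int m + (p + p')")
    case True
    define t where "t = nat (int m + (p + p') - int n)"
    have t: "int t = int m + (p + p') - int n" using True by (simp add: t_def)
    have "(\<Sum>k<N. entry P m k * entry Q k n) = (\<Sum>a\<le>t. \<phi> a (int m) * \<psi> (t - a) (int m + (p - int a)))"
    proof -
      have "(\<Sum>k<N. entry P m k * entry Q k n) = (\<Sum>k | k < N \<and> int n \<le> int k + p'. entry P m k * entry Q k n)"
        by (rule sum.mono_neutral_right) (auto intro!: has_symbol_entry_0[OF Q])
      also have "\<dots> = (\<Sum>a | a \<le> t \<and> int a \<le> int m + p. \<phi> a (int m) * \<psi> (t - a) (int m + (p - int a)))"
      proof (rule sum.reindex_bij_witness[where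
            j = "\<lambda>k. nat (int m + p - int k)" and i = "\<lambda>a. nat (int m + p - int a)"])
        fix k assume "k \<in> {k. k < N \<and> int n \<le> int k + p'}"
        then have k: "int k \<le> int m + p" "int n \<le> int k + p'" by (auto simp: N_def)
        then show "nat (int m + p - int (nat (int m + p - int k))) = k"
          "nat (int m + p - int k) \<in> {a. a \<le> t \<and> int a \<le> int m + p}"
          using t by auto
        have "entry P m k = \<phi> (nat (int m + p - int k)) (int m)"
          by (rule has_symbol_entry[OF P]) (use k in simp)
        moreover have "entry Q k n = \<psi> (t - nat (int m + p - int k)) (int k)"
          by (rule has_symbol_entry[OF Q]) (use k t in simp)
        ultimately show "\<phi> (nat (int m + p - int k)) (int m) * \<psi> (t - nat (int m + p - int k))
            (int m + (p - int (nat (int m + p - int k)))) = entry P m k * entry Q k n"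
          using k by simp
      qed (use t in \<open>auto simp: N_def\<close>)
      \<comment> \<open>A term with \<open>a > m + p\<close> would pass through a negative index;
        there \<open>\<phi> a\<close> vanishes.\<close>
      also have "\<dots> = (\<Sum>a\<le>t. \<phi> a (int m) * \<psi> (t - a) (int m + (p - int a)))"
        by (rule sum.mono_neutral_left) (auto, metis has_symbol_vanish[OF P] not_le)
      finally show ?thesis .
    qed
    with True show ?thesis by (simp add: PQ symbol_mult_def t_def)
  next
    case False
    have "entry P m k * entry Q k n = 0" for k
      using has_symbol_entry_0[OF P, of m k] has_symbol_entry_0[OF Q, of k n] False
      by (cases "int k \<le> int m + p") auto
    then have "entry (P * Q) m n = 0" unfolding PQ by (rule sum.neutral[OF ballI])
    with False show ?thesis by simp
  qed
next
  fix t m assume tm: "int m + (p + p') < int t"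
  \<comment> \<open>Either \<open>\<phi> a\<close> vanishes at \<open>m\<close>, or the intermediate
    index is nonnegative and \<open>\<psi> (t - a)\<close> vanishes there.\<close>
  have "\<phi> a (int m) * \<psi> (t - a) (int m + (p - int a)) = 0" if "a \<le> t" for a
  proof (cases "int a \<le> int m + p")
    case True
    then have "int (nat (int m + (p - int a))) = int m + (p - int a)" by simp
    then have "\<psi> (t - a) (int m + (p - int a)) = 0"
      using has_symbol_vanish[OF Q, of "nat (int m + (p - int a))" "t - a"] tm that by simp
    then show ?thesis by simp
  qed (simp add: has_symbol_vanish[OF P])
  then show "symbol_mult p \<phi> \<psi> t (int m) = 0"
    unfolding symbol_mult_def by (intro sum.neutral ballI) simp
qed

text \<open>The degrees \<open>a - 1\<close> and \<open>Suc t - a - 1\<close> add up to at most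
  \<open>t\<close>; the value \<open>t\<close> is reached at \<open>a = 0\<close> and
  \<open>a = Suc t\<close>, where one of the subtractions is truncated.\<close>

lemma admissible_symbol_mult:
  assumes "admissible q \<phi>" "admissible q \<psi>"
  shows "admissible q (symbol_mult p \<phi> \<psi>)"
  unfolding admissible_def
proof (intro conjI allI)
  obtain c c' where "c \<noteq> 0" "\<phi> 0 = (\<lambda>_. c)" "c' \<noteq> 0" "\<psi> 0 = (\<lambda>_. c')"
    using assms by (auto simp: admissible_def)
  then show "\<exists>c. c \<noteq> 0 \<and> symbol_mult p \<phi> \<psi> 0 = (\<lambda>_. c)"
    by (intro exI[of _ "c * c'"]) (simp add: symbol_mult_def fun_eq_iff)
next
  fix t
  have "quasi_poly q t (\<lambda>m. \<phi> a m * \<psi> (Suc t - a) (m + (p - int a)))" if "a \<le> Suc t" for a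
    by (rule quasi_poly_mono[OF quasi_poly_mult[OF admissible_quasi_poly[OF assms(1)]
        quasi_poly_shift[OF admissible_quasi_poly[OF assms(2)]]]]) (use that in linarith)
  then show "quasi_poly q t (symbol_mult p \<phi> \<psi> (Suc t))"
    unfolding symbol_mult_def by (intro quasi_poly_sum) simp
qed

section \<open>The inverse of a symbol with leading term 1\<close>

text \<open>The recursion solves \<open>symbol_mult 0 \<sigma> \<tau> t = 0\<close> for
  \<open>\<tau> t\<close> when \<open>t > 0\<close> and \<open>\<sigma> 0 = \<tau> 0 = 1\<close>;
  the summand \<open>c\<close> is the one with \<open>a = t - c\<close>.\<close>

fun inverse_symbol :: "(nat \<Rightarrow> int \<Rightarrow> 'a::field_char_0) \<Rightarrow> nat \<Rightarrow> int \<Rightarrow> 'a" where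
  "inverse_symbol \<sigma> t m =
    (if t = 0 then 1 else - (\<Sum>c<t. \<sigma> (t - c) m * inverse_symbol \<sigma> c (m - int (t - c))))"

declare inverse_symbol.simps [simp del]

lemma inverse_symbol_0: "inverse_symbol \<sigma> 0 = (\<lambda>_. 1)"
  by (simp add: inverse_symbol.simps fun_eq_iff)

text \<open>For \<open>c < t\<close> the degrees \<open>t - c - 1\<close> and \<open>c - 1\<close>
  add up to at most \<open>t - 1\<close>.\<close>

lemma quasi_poly_inverse_symbol:
  assumes "admissible q \<sigma>"
  shows "quasi_poly q (t - 1) (inverse_symbol \<sigma> t)"
proof (induction t rule: less_induct)
  case (less t)
  show ?case
  proof (cases "t = 0")
    case True
    then show ?thesis by (simp add: inverse_symbol_0 quasi_poly_const)
  next
    case False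
    then have eq: "inverse_symbol \<sigma> t =
        (\<lambda>m. - (\<Sum>c<t. \<sigma> (t - c) m * inverse_symbol \<sigma> c (m + (- int (t - c)))))"
      by (intro ext) (simp only: inverse_symbol.simps[of \<sigma> t] if_False diff_conv_add_uminus)
    show ?thesis
      unfolding eq
    proof (intro quasi_poly_uminus quasi_poly_sum)
      fix c assume "c \<in> {..<t}"
      then have "c < t" by simp
      show "quasi_poly q (t - 1) (\<lambda>m. \<sigma> (t - c) m * inverse_symbol \<sigma> c (m + (- int (t - c))))"
        by (rule quasi_poly_mono[OF quasi_poly_mult[OF admissible_quasi_poly[OF assms]
            quasi_poly_shift[OF less.IH[OF \<open>c < t\<close>]]]]) (use \<open>c < t\<close> in linarith)
    qed
  qed
qed

text \<open>\<open>S\<close> is lower triangular with unit diagonal, so \<open>S * T = 1\<close>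
  determines row \<open>m\<close> of \<open>T\<close> from the rows before it.\<close>

lemma has_symbol_inverse:
  assumes S: "has_symbol S 0 \<sigma>" and \<sigma>0: "\<sigma> 0 = (\<lambda>_. 1)" and ST: "S * T = 1"
  shows "has_symbol T 0 (inverse_symbol \<sigma>)"
proof -
  have *: "entry T m n = (if n \<le> m then inverse_symbol \<sigma> (m - n) (int m) else 0)" for m n
  proof (induction m rule: less_induct)
    case (less m)
    have "(if m = n then 1 else 0) = entry (S * T) m n" by (simp add: ST entry_1)
    also have "\<dots> = (\<Sum>k<Suc m. entry S m k * entry T k n)"
      by (rule entry_mult[OF has_symbol_ord_bound[OF S]]) simp
    also have "\<dots> = (\<Sum>k<m. \<sigma> (m - k) (int m) * entry T k n) + entry T m n"
    proof -
      have "entry S m k = \<sigma> (m - k) (int m)" if "k \<le> m" for k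
        by (rule has_symbol_entry[OF S]) (use that in simp)
      then show ?thesis by (simp add: \<sigma>0)
    qed
    also have "(\<Sum>k<m. \<sigma> (m - k) (int m) * entry T k n)
      = (\<Sum>k<m. if n \<le> k then \<sigma> (m - k) (int m) * inverse_symbol \<sigma> (k - n) (int k) else 0)"
      by (intro sum.cong refl) (simp add: less)
    also have "\<dots> = (\<Sum>k\<in>{n..<m}. \<sigma> (m - k) (int m) * inverse_symbol \<sigma> (k - n) (int k))"
      by (rule sum.mono_neutral_cong_right) auto
    also have "\<dots> = (\<Sum>c<m - n. \<sigma> (m - n - c) (int m) * inverse_symbol \<sigma> c (int m - int (m - n - c)))"
      by (rule sum.reindex_bij_witness[where i = "\<lambda>c. n + c" and j = "\<lambda>k. k - n"]) (auto simp: of_nat_diff)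
    finally have eq: "(if m = n then 1 else 0) = (\<Sum>c<m - n. \<sigma> (m - n - c) (int m)
        * inverse_symbol \<sigma> c (int m - int (m - n - c))) + entry T m n" .
    show ?case
    proof (cases "n < m")
      case True
      then have "entry T m n = - (\<Sum>c<m - n. \<sigma> (m - n - c) (int m)
        * inverse_symbol \<sigma> c (int m - int (m - n - c)))"
        using eq by (intro minus_unique[symmetric]) simp
      also have "\<dots> = inverse_symbol \<sigma> (m - n) (int m)"
        unfolding inverse_symbol.simps[of \<sigma> "m - n" "int m"] using True by simp
      finally show ?thesis using True by simp
    next
      case False
      then show ?thesis using eq by (auto simp: inverse_symbol_0)
    qed
  qed
  \<comment> \<open>In each summand either \<open>t - c > m\<close> and
    \<open>\<sigma> (t - c)\<close> vanishes, or the argument \<open>m - (t - c)\<close> is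
    nonnegative and less than \<open>c\<close>, which the induction covers.\<close>
  have van: "int m < int t \<Longrightarrow> inverse_symbol \<sigma> t (int m) = 0" for t m
  proof (induction t arbitrary: m rule: less_induct)
    case (less t)
    have 0: "\<sigma> (t - c) (int m) * inverse_symbol \<sigma> c (int m - int (t - c)) = 0" if "c < t" for c
    proof (cases "t - c \<le> m")
      case True
      then have "int m - int (t - c) = int (m - (t - c))" by simp
      moreover have "inverse_symbol \<sigma> c (int (m - (t - c))) = 0"
        by (rule less.IH) (use that less.prems True in auto)
      ultimately show ?thesis by (simp only: mult_zero_right)
    next
      case False
      then show ?thesis using has_symbol_vanish[OF S, of m "t - c"] by simp
    qed
    have "inverse_symbol \<sigma> t (int m)
        = - (\<Sum>c<t. \<sigma> (t - c) (int m) * inverse_symbol \<sigma> c (int m - int (t - c)))"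
      unfolding inverse_symbol.simps[of \<sigma> t "int m"] using less.prems by simp
    also have "\<dots> = 0"
      unfolding neg_equal_0_iff_equal by (intro sum.neutral ballI 0) simp
    finally show ?case .
  qed
  have "nat (int m - int n) = m - n" for m n by simp
  then show ?thesis
    unfolding has_symbol_def by (intro conjI allI impI) (simp_all add: * van)
qed

section \<open>Schur operators\<close>

text \<open>The symbol, relative to order \<open>q\<close>, of the terms below
  \<open>\<partial>^q\<close>: the term \<open>x^j \<partial>^k\<close> has order
  \<open>q - a\<close> for \<open>j = a + k - q\<close>, and its entry in row \<open>m\<close> is
  the falling factorial of \<open>m\<close> of length \<open>j\<close>.\<close>

definition normal_coeff :: "nat \<Rightarrow> (nat \<Rightarrow> 'a::field_char_0 fps) \<Rightarrow> nat \<Rightarrow> 'a poly" where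
  "normal_coeff q c a = (\<Sum>k<q - 1. if q \<le> a + k
     then smult (c k $ (a + k - q)) (ffpoly (a + k - q)) else 0)"

lemma entry_normalized:
  fixes c :: "nat \<Rightarrow> 'a::field_char_0 fps"
  shows "entry (del_op ^ q + (\<Sum>k<q - 1. of_fps (c k) * del_op ^ k)) m n =
    (if n = m + q then 1 else 0) + (if n \<le> m + q then poly (normal_coeff q c (m + q - n)) (of_nat m) else 0)"
proof -
  have top: "entry (del_op ^ q :: 'a dsym) m n = (if n = m + q then 1 else 0)"
    by (auto simp: entry_def act_del_power fps_nth_deriv_dpow dpow_nth)
  have low: "entry (of_fps (c k) * del_op ^ k) m n = (if n \<le> m + q then
      poly (if q \<le> (m + q - n) + k then smult (c k $ ((m + q - n) + k - q)) (ffpoly ((m + q - n) + k - q)) else 0)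
        (of_nat m) else 0)" if "k < q - 1" for k
  proof (cases "n \<le> m + k \<and> k \<le> n")
    case True
    then have "(m + q - n) + k - q = m + k - n" "m - (m + k - n) = n - k" "m - (n - k) = m + k - n"
      "n \<le> m + q" "q \<le> (m + q - n) + k" "n - k \<le> m" "m + k - n \<le> m"
      using that by auto
    moreover have "(c k * dpow (n - k)) $ m = (if n - k \<le> m then c k $ (m - (n - k)) / fact (n - k) else 0)"
      unfolding dpow_def mult.left_commute[of _ "fps_const _"]
      by (simp add: fps_X_power_mult_right_nth)
    ultimately show ?thesis
      using True by (simp add: entry_def act_mult act_of_fps act_del_power fps_nth_deriv_dpow poly_ffpoly)
  next
    \<comment> \<open>Outside this range both sides vanish. For \<open>k > n\<close> the derivative
      kills \<open>dpow n\<close>, and \<open>m\<close> is a root of the falling factorial; for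
      \<open>n > m + k\<close> the power of \<open>x\<close> in \<open>dpow (n - k)\<close> exceeds
      \<open>m\<close>.\<close>
    case False
    show ?thesis
    proof (cases "k \<le> n")
      case True
      with False have "m < n - k" by auto
      then have "(c k * dpow (n - k)) $ m = 0"
        unfolding dpow_def mult.left_commute[of _ "fps_const _"]
        by (simp add: fps_X_power_mult_right_nth)
      moreover have "\<not> q \<le> (m + q - n) + k" if "n \<le> m + q" using False True that by auto
      ultimately show ?thesis
        using True by (simp add: entry_def act_mult act_of_fps act_del_power fps_nth_deriv_dpow)
    next
      case False
      then show ?thesis
        by (simp add: entry_def act_mult act_of_fps act_del_power fps_nth_deriv_dpow poly_ffpoly act_zero_right)
    qed
  qed
  have "entry (\<Sum>k<q - 1. of_fps (c k) * del_op ^ k) m n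
    = (\<Sum>k<q - 1. entry (of_fps (c k) * del_op ^ k) m n)"
    by (simp add: entry_def act_sum_left fps_sum_nth sum_distrib_left)
  also have "\<dots> = (\<Sum>k<q - 1. if n \<le> m + q then
      poly (if q \<le> (m + q - n) + k then smult (c k $ ((m + q - n) + k - q)) (ffpoly ((m + q - n) + k - q)) else 0)
        (of_nat m) else 0)"
    by (rule sum.cong[OF refl], rule low) simp
  also have "\<dots> = (if n \<le> m + q then poly (normal_coeff q c (m + q - n)) (of_nat m) else 0)"
    unfolding normal_coeff_def poly_sum by simp
  finally show ?thesis by (simp only: entry_add top)
qed

text \<open>This is where the missing \<open>\<partial>^(q - 1)\<close> term enters:
  \<open>k < q - 1\<close> and \<open>a < 2\<close> force \<open>a + k < q\<close>.\<close>

lemma normal_coeff_0: "a < 2 \<Longrightarrow> normal_coeff q c a = 0"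
  by (auto simp: normal_coeff_def intro!: sum.neutral)

lemma degree_normal_coeff: "degree (normal_coeff q c a) \<le> a - 2"
  unfolding normal_coeff_def
  by (rule degree_sum_le) (auto simp: degree_ffpoly intro: degree_smult_le[THEN order_trans])

text \<open>The falling factorials that occur have length greater than \<open>m\<close>, so
  \<open>m\<close> is a root.\<close>

lemma poly_normal_coeff_vanish:
  "m + q < a \<Longrightarrow> poly (normal_coeff q c a) (of_nat m :: 'a::field_char_0) = 0"
  by (auto simp: normal_coeff_def poly_sum poly_ffpoly intro!: sum.neutral)

text \<open>The subdiagonals of \<open>S\<close> satisfy difference equations with step
  \<open>q\<close>, solved by strong induction on their index through
  \<open>quasi_poly_difference\<close>.\<close>

lemma schur_has_symbol:
  fixes c :: "nat \<Rightarrow> 'a::field_char_0 fps"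
  assumes q: "q > 0"
    and QS: "(del_op ^ q + (\<Sum>k<q - 1. of_fps (c k) * del_op ^ k)) * S = S * del_op ^ q"
    and S: "ord_bound S 0" "hcomp S 0 = 1" "hcomp S (- 1) = 0"
  obtains \<sigma> where "has_symbol S 0 \<sigma>" "admissible q \<sigma>" "\<sigma> 0 = (\<lambda>_. 1)"
proof -
  define Q where "Q = del_op ^ q + (\<Sum>k<q - 1. of_fps (c k) * del_op ^ k)"
  note Q = entry_normalized[of q c, folded Q_def]
  define \<kappa> where "\<kappa> a m = poly (normal_coeff q c a) (of_int m)" for a and m :: int
  have upper: "entry S m n = 0" if "n > m" for m n
    using S(1) that by (simp add: entry_eq_0)
  have S0: "entry S m m = 1" for m
    using entry_hcomp[of S 0 m m] S(2) by (simp add: entry_1)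
  have S1: "entry S (Suc m) m = 0" for m
    using entry_hcomp[of S "- 1" "Suc m" m] S(3) by (simp add: entry_0)
  \<comment> \<open>The subdiagonal of index \<open>t\<close>, continued by 0 where its column
    \<open>m - t\<close> would be negative; this is the vanishing condition in
    \<open>has_symbol\<close>.\<close>
  define s where "s t m = (if t \<le> m then entry S m (m - t) else 0)" for t m
  \<comment> \<open>Entry \<open>(m, m + q - t)\<close> of \<open>Q S = S \<partial>^q\<close>: on
    the left the leading \<open>\<partial>^q\<close> moves the row by \<open>q\<close>, on the right
    it moves the column by \<open>q\<close>.\<close>
  have rec: "s t (m + q) - s t m = - (\<Sum>a\<in>{2..t}. \<kappa> a (int m) * s (t - a) (m + q - a))"
    if "t \<le> m + q" for t m
  proof -
    define n where "n = m + q - t"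
    have "ord_bound Q (int q)"
      unfolding ord_bound_iff_entry Q by auto
    then have "entry (Q * S) m n = (\<Sum>k<Suc (m + q). entry Q m k * entry S k n)"
      by (rule entry_mult) simp
    also have "\<dots> = entry S (m + q) n + (\<Sum>k<Suc (m + q). \<kappa> (m + q - k) (int m) * entry S k n)"
    proof -
      have "(\<Sum>k<Suc (m + q). entry Q m k * entry S k n)
        = (\<Sum>k<Suc (m + q). (if k = m + q then entry S (m + q) n else 0) + \<kappa> (m + q - k) (int m) * entry S k n)"
        by (intro sum.cong refl) (simp add: Q \<kappa>_def algebra_simps)
      then show ?thesis by (simp only: sum.distrib sum.delta finite_lessThan) simp
    qed
    also have "(\<Sum>k<Suc (m + q). \<kappa> (m + q - k) (int m) * entry S k n)
      = (\<Sum>a\<in>{2..t}. \<kappa> a (int m) * s (t - a) (m + q - a))"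
    proof -
      \<comment> \<open>With \<open>a = m + q - k\<close>, a nonzero term has
        \<open>a \<le> t\<close> by triangularity of \<open>S\<close> and \<open>a \<ge> 2\<close>
        by \<open>normal_coeff_0\<close>.\<close>
      have "(\<Sum>k<Suc (m + q). \<kappa> (m + q - k) (int m) * entry S k n)
        = (\<Sum>k | n \<le> k \<and> k + 2 \<le> m + q. \<kappa> (m + q - k) (int m) * entry S k n)"
      proof (rule sum.mono_neutral_right)
        have "\<kappa> (m + q - k) (int m) * entry S k n = 0" if "\<not> (n \<le> k \<and> k + 2 \<le> m + q)" for k
          using that by (cases "n \<le> k") (auto simp: upper \<kappa>_def normal_coeff_0)
        then show "\<forall>k\<in>{..<Suc (m + q)} - {k. n \<le> k \<and> k + 2 \<le> m + q}. \<kappa> (m + q - k) (int m) * entry S k n = 0"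
          by blast
      qed auto
      also have "\<dots> = (\<Sum>a\<in>{2..t}. \<kappa> a (int m) * s (t - a) (m + q - a))"
        by (rule sum.reindex_bij_witness[where i = "\<lambda>a. m + q - a" and j = "\<lambda>k. m + q - k"])
           (use that in \<open>auto simp: n_def s_def\<close>)
      finally show ?thesis .
    qed
    finally have "entry (Q * S) m n = s t (m + q) + (\<Sum>a\<in>{2..t}. \<kappa> a (int m) * s (t - a) (m + q - a))"
      using that by (simp add: s_def n_def)
    moreover have "entry (S * del_op ^ q) m n = s t m"
      using entry_mult_D_pow[of S "int q" m n] that by (auto simp: D_pow_def s_def n_def nat_diff_distrib)
    ultimately have "s t m = s t (m + q) + (\<Sum>a\<in>{2..t}. \<kappa> a (int m) * s (t - a) (m + q - a))"
      using QS unfolding Q_def by simp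
    then show ?thesis by simp
  qed
  have "\<exists>\<sigma>. quasi_poly q (t - 1) \<sigma> \<and> (\<forall>m. \<sigma> (int m) = s t m)" for t
  proof (induction t rule: less_induct)
    case (less t)
    then have "\<forall>b. \<exists>\<sigma>. b < t \<longrightarrow> quasi_poly q (b - 1) \<sigma> \<and> (\<forall>m. \<sigma> (int m) = s b m)" by blast
    from choice[OF this] obtain \<sigma> where \<sigma>: "\<And>b. b < t \<Longrightarrow> quasi_poly q (b - 1) (\<sigma> b)"
      "\<And>b m. b < t \<Longrightarrow> \<sigma> b (int m) = s b m" by blast
    show ?case
    proof (cases "t < 2")
      case True
      \<comment> \<open>The base cases are the normalizations of the components of \<open>S\<close>
        of order 0 and -1; the difference equation takes over at \<open>t = 2\<close>.\<close>
      then consider "t = 0" | "t = 1" by linarith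
      then show ?thesis
      proof cases
        case 1
        then have "s t m = 1" for m by (simp add: s_def S0)
        then show ?thesis using quasi_poly_const[of q "t - 1" 1] by auto
      next
        case 2
        have "s t m = 0" for m using S1[of "m - 1"] 2 by (auto simp: s_def)
        then show ?thesis using quasi_poly_const[of q "t - 1" 0] by auto
      qed
    next
      case False
      \<comment> \<open>The right-hand side of \<open>rec\<close> on all integers. The degrees
        \<open>a - 2\<close> and \<open>t - a - 1\<close> add up to at most \<open>t - 2\<close>,
        with equality at \<open>a = t\<close>.\<close>
      define R where "R m = - (\<Sum>a\<in>{2..t}. \<kappa> a m * \<sigma> (t - a) (m + (int q - int a)))" for m
      have "quasi_poly q (t - 2) R"
        unfolding R_def
      proof (intro quasi_poly_uminus quasi_poly_sum)
        fix a assume "a \<in> {2..t}"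
        then have a: "2 \<le> a" "a \<le> t" "t - a < t" by auto
        have "quasi_poly q (a - 2) (\<kappa> a)"
          unfolding \<kappa>_def by (rule quasi_poly_poly[OF degree_normal_coeff])
        from quasi_poly_mult[OF this quasi_poly_shift[OF \<sigma>(1)[OF a(3)]]]
        show "quasi_poly q (t - 2) (\<lambda>m. \<kappa> a m * \<sigma> (t - a) (m + (int q - int a)))"
          by (rule quasi_poly_mono) (use a in linarith)
      qed
      moreover have "s t (m + q) - s t m = R (int m)" for m
      proof -
        have "\<kappa> a (int m) * \<sigma> (t - a) (int m + (int q - int a)) = \<kappa> a (int m) * s (t - a) (m + q - a)"
          if "a \<in> {2..t}" for a
        proof (cases "a \<le> m + q")
          case True
          then have "int m + (int q - int a) = int (m + q - a)" by simp
          then show ?thesis using \<sigma>(2)[of "t - a" "m + q - a"] that by simp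
        next
          case False
          then have "\<kappa> a (int m) = 0" by (simp add: \<kappa>_def poly_normal_coeff_vanish)
          then show ?thesis by simp
        qed
        then have R: "R (int m) = - (\<Sum>a\<in>{2..t}. \<kappa> a (int m) * s (t - a) (m + q - a))"
          unfolding R_def by (intro arg_cong[where f = uminus] sum.cong refl)
        show ?thesis
        proof (cases "t \<le> m + q")
          case True
          then show ?thesis by (simp only: R rec)
        next
          \<comment> \<open>Here there is no matrix entry to compare. The left side is 0 by the
            convention in \<open>s\<close>, and in each summand on the right
            \<open>\<kappa> a\<close> or \<open>s (t - a)\<close> vanishes.\<close>
          case False
          have "\<kappa> a (int m) * s (t - a) (m + q - a) = 0" if "a \<in> {2..t}" for a
          proof (cases "a \<le> m + q")
            case True
            with False have "m + q - a < t - a" by linarith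
            then show ?thesis by (simp add: s_def)
          qed (simp add: \<kappa>_def poly_normal_coeff_vanish)
          then have "R (int m) = 0"
            unfolding R neg_equal_0_iff_equal by (rule sum.neutral[OF ballI])
          with False show ?thesis by (simp add: s_def)
        qed
      qed
      ultimately have "\<exists>\<sigma>. quasi_poly q (Suc (t - 2)) \<sigma> \<and> (\<forall>m. \<sigma> (int m) = s t m)"
        by (rule quasi_poly_difference[OF _ q])
      moreover have "Suc (t - 2) = t - 1" using False by simp
      ultimately show ?thesis by simp
    qed
  qed
  then have "\<forall>t. \<exists>\<sigma>. quasi_poly q (t - 1) \<sigma> \<and> (\<forall>m. \<sigma> (int m) = s t m)" by blast
  from choice[OF this] obtain \<sigma>
    where \<sigma>: "\<And>t. quasi_poly q (t - 1) (\<sigma> t)" "\<And>t m. \<sigma> t (int m) = s t m" by blast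
  \<comment> \<open>\<open>\<sigma> 0\<close> is prescribed only at nonnegative arguments; it is
    replaced by the constant 1, as \<open>admissible\<close> and \<open>has_symbol_inverse\<close>
    demand.\<close>
  define \<sigma>' where "\<sigma>' = \<sigma>(0 := \<lambda>_. 1)"
  have \<sigma>': "\<sigma>' t (int m) = s t m" for t m
    by (simp add: \<sigma>'_def \<sigma>(2) s_def S0)
  show ?thesis
  proof
    show "has_symbol S 0 \<sigma>'"
      unfolding has_symbol_def
    proof (intro conjI allI impI)
      fix m n
      have "nat (int m - int n) = m - n" by simp
      then show "entry S m n = (if int n \<le> int m + 0 then \<sigma>' (nat (int m + 0 - int n)) (int m) else 0)"
        using upper[of m n] by (simp add: \<sigma>' s_def)
    qed (simp add: \<sigma>' s_def)
    show "admissible q \<sigma>'"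
      using \<sigma>(1)[of "Suc _"] by (auto simp: admissible_def \<sigma>'_def intro!: exI[of _ 1])
    show "\<sigma>' 0 = (\<lambda>_. 1)" by (simp add: \<sigma>'_def)
  qed
qed

section \<open>Conjugation by the Schur operator\<close>

theorem corollary2p4:
  fixes K :: "'a::field_char_0 set" and \<xi> :: 'a
    and P Q S Sinv :: "'a dsym" and q :: nat and p :: int
  assumes "subfield_set K"
    and "adjoin K \<xi> = UNIV"
    and "primitive_root_of_unity q \<xi>"
    and "normalized K q Q"
    and "op_ord Q = ereal (real q)"
    and "op_deg Q = q"
    and "q > 0"
    and "condition_A \<xi> q 0 P"
    and "op_ord P = ereal (real_of_int p)"
    and "schur_operator K q Q S Sinv"
  shows "condition_A \<xi> q 0 (Sinv * P * S)"
proof -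
  from assms(4) obtain c where Q: "Q = del_op ^ q + (\<Sum>k<q - 1. of_fps (c k) * del_op ^ k)"
    by (auto simp: normalized_def)
  have S: "S * Sinv = 1" "Sinv * Q * S = del_op ^ q" "op_ord S = 0" "hcomp S 0 = 1" "hcomp S (- 1) = 0"
    using assms(10) by (auto simp: schur_operator_def)
  have "Q * S = S * del_op ^ q"
    unfolding S(2)[symmetric] by (simp add: S(1) flip: mult.assoc)
  moreover have "ord_bound S 0"
    using op_ord_le_iff[of S 0] S(3) by simp
  ultimately obtain \<sigma> where \<sigma>: "has_symbol S 0 \<sigma>" "admissible q \<sigma>" "\<sigma> 0 = (\<lambda>_. 1)"
    unfolding Q by (rule schur_has_symbol[OF assms(7) _ _ S(4,5)])
  have Sinv: "has_symbol Sinv 0 (inverse_symbol \<sigma>)"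
    by (rule has_symbol_inverse[OF \<sigma>(1,3) S(1)])
  have adm: "admissible q (inverse_symbol \<sigma>)"
    using quasi_poly_inverse_symbol[OF \<sigma>(2), of "Suc _"]
    by (auto simp: admissible_def inverse_symbol_0 intro!: exI[of _ 1])
  obtain \<phi> where \<phi>: "has_symbol P p \<phi>" "admissible q \<phi>"
    by (rule condition_A_imp_symbol[OF assms(3,8,9)])
  have "q > 1" using assms(8) by (simp add: condition_A_def)
  \<comment> \<open>The symbols of the three factors, of orders 0, \<open>p\<close> and 0, compose
    to an admissible symbol of \<open>Sinv * P * S\<close>, which translates back into
    \<open>condition_A\<close>.\<close>
  then show ?thesis
    by (rule symbol_imp_condition_A[OF assms(3) _
        has_symbol_mult[OF has_symbol_mult[OF Sinv \<phi>(1)] \<sigma>(1)]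
        admissible_symbol_mult[OF admissible_symbol_mult[OF adm \<phi>(2)] \<sigma>(2)]])
qed

end
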